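(* Let $f$ be a Brouwer-mapping function with complexity parameter $n$ (computed by a Brouwer-mapping circuit). Then $f$ can be implemented by a linear arithmetic circuit having $\mathrm{poly}(n)$ gates that computes a continuous function $K\to K$, where $K=[0,1]^3$.
   Context: For $n\in\mathbb{N}$, $K=[0,1]^3$ is partitioned into $2^{3n}$ cubelets $K_{ijk}$, $0\le i,j,k\le 2^n-1$, where $K_{ijk}$ is the axis-aligned cube of side $2^{-n}$ with vertex closest to the origin $2^{-n}(i,j,k)$. A Brouwer-mapping circuit with parameter $n$ is a Boolean circuit with $3n$ inputs and $2$ outputs; it defines a Brouwer-mapping function $f$ mapping each cubelet to a color in $\{0,1,2,3\}$, with exterior cubelets (some index equal to $0$ or $2^n-1$) colored as follows: color $1$ if $i=0$; color $2$ if $j=0,i>0$; color $3$ if $k=0$, $i,j>0$; color $0$ otherwise. A linear arithmetic circuit is a directed acyclic circuit computing a function $K\to K$ (three input nodes, three output nodes) whose gates each take $0$, $1$ or $2$ inputs in $[0,1]$ and output a value in $[0,1]$: the sum, difference, max or min of two inputs, a constant multiple of one input, or a constant; results are truncated to $[0,1]$ (e.g. a sum exceeding $1$ outputs $1$). Comparator gates are also allowed: output $1$ if the first input exceeds the second, $0$ if it is smaller, and any value if they are equal. Let $\alpha=2^{-2n}$, $\delta_1=(\alpha,0,0)$, $\delta_2=(0,\alpha,0)$, $\delta_3=(0,0,\alpha)$, $\delta_0=(-\alpha,-\alpha,-\alpha)$. A circuit $C$ computing a function $K\to K$ implements $f$ if: whenever $f(K_{ijk})=c$ and $x$ is the center of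 $K_{ijk}$, $C(x)-x=\delta_c$; and for $x$ not a cubelet center, $C(x)-x$ is a convex combination of the vectors $C(z)-z$ over cubelet centers $z$ within $L_\infty$ distance $2^{-n}$ of $x$.
   Formalization: The number of gates is bounded by a polynomial in n and the size of the given Boolean circuit (poly(n) when that circuit has size poly(n)), since no bound in n alone can hold for Boolean circuits of arbitrary size; n ≥ 1 is assumed, as the claim fails for n = 0. *)

theory Defs
  imports "HOL-Analysis.Analysis"
begin

text \<open>A Boolean circuit is a list of gates; gate number k may only refer to
  gates with smaller index. Inputs are read by BIn gates. The two outputs are
  designated gate indices.\<close>

datatype bgate = BIn nat | BConst bool | BNot nat | BAnd nat nat | BOr nat nat

type_synonym bcircuit = "bgate list \<times> nat \<times> nat"

fun bgate_wf :: "nat \<Rightarrow> nat \<Rightarrow> bgate \<Rightarrow> bool" where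
  "bgate_wf m k (BIn i) = (i < m)"
| "bgate_wf m k (BConst b) = True"
| "bgate_wf m k (BNot a) = (a < k)"
| "bgate_wf m k (BAnd a b) = (a < k \<and> b < k)"
| "bgate_wf m k (BOr a b) = (a < k \<and> b < k)"

definition bcircuit_wf :: "nat \<Rightarrow> bcircuit \<Rightarrow> bool" where
  "bcircuit_wf m C = (case C of (gs, o1, o2) \<Rightarrow>
     (\<forall>k<length gs. bgate_wf m k (gs ! k)) \<and> o1 < length gs \<and> o2 < length gs)"

fun bgate_eval :: "(nat \<Rightarrow> bool) \<Rightarrow> bool list \<Rightarrow> bgate \<Rightarrow> bool" where
  "bgate_eval x vs (BIn i) = x i"
| "bgate_eval x vs (BConst b) = b"
| "bgate_eval x vs (BNot a) = (\<not> vs ! a)"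
| "bgate_eval x vs (BAnd a b) = (vs ! a \<and> vs ! b)"
| "bgate_eval x vs (BOr a b) = (vs ! a \<or> vs ! b)"

definition bvals :: "(nat \<Rightarrow> bool) \<Rightarrow> bgate list \<Rightarrow> bool list" where
  "bvals x gs = foldl (\<lambda>vs g. vs @ [bgate_eval x vs g]) [] gs"

definition bcircuit_out :: "bcircuit \<Rightarrow> (nat \<Rightarrow> bool) \<Rightarrow> bool \<times> bool" where
  "bcircuit_out C x = (case C of (gs, o1, o2) \<Rightarrow>
     (let vs = bvals x gs in (vs ! o1, vs ! o2)))"

definition bsize :: "bcircuit \<Rightarrow> nat" where "bsize C = length (fst C)"

definition brouwer_circuit :: "nat \<Rightarrow> bcircuit \<Rightarrow> bool" where
  "brouwer_circuit n C = bcircuit_wf (3 * n) C"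

definition nbit :: "nat \<Rightarrow> nat \<Rightarrow> bool" where "nbit a t = odd (a div 2 ^ t)"

definition cube_input :: "nat \<Rightarrow> nat \<Rightarrow> nat \<Rightarrow> nat \<Rightarrow> nat \<Rightarrow> bool" where
  "cube_input n i j k t =
     (if t < n then nbit i t else if t < 2 * n then nbit j (t - n) else nbit k (t - 2 * n))"

definition brouwer_fun :: "nat \<Rightarrow> bcircuit \<Rightarrow> nat \<Rightarrow> nat \<Rightarrow> nat \<Rightarrow> nat" where
  "brouwer_fun n C i j k =
     (if i = 0 then 1
      else if j = 0 then 2
      else if k = 0 then 3
      else if i = 2 ^ n - 1 \<or> j = 2 ^ n - 1 \<or> k = 2 ^ n - 1 then 0
      else (case bcircuit_out C (cube_input n i j k) of
              (b1, b0) \<Rightarrow> 2 * of_bool b1 + of_bool b0))"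

datatype lgate = LIn nat | LConst real | LAdd nat nat | LSub nat nat
  | LMax nat nat | LMin nat nat | LScale real nat | LCmp nat nat

type_synonym lcircuit = "lgate list \<times> nat \<times> nat \<times> nat"

type_synonym point = "real \<times> real \<times> real"

fun lgate_wf :: "nat \<Rightarrow> lgate \<Rightarrow> bool" where
  "lgate_wf k (LIn i) = (i < 3)"
| "lgate_wf k (LConst c) = True"
| "lgate_wf k (LAdd a b) = (a < k \<and> b < k)"
| "lgate_wf k (LSub a b) = (a < k \<and> b < k)"
| "lgate_wf k (LMax a b) = (a < k \<and> b < k)"
| "lgate_wf k (LMin a b) = (a < k \<and> b < k)"
| "lgate_wf k (LScale c a) = (a < k)"
| "lgate_wf k (LCmp a b) = (a < k \<and> b < k)"

definition lcircuit_wf :: "lcircuit \<Rightarrow> bool" where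
  "lcircuit_wf L = (case L of (gs, o1, o2, o3) \<Rightarrow>
     (\<forall>k<length gs. lgate_wf k (gs ! k)) \<and>
     o1 < length gs \<and> o2 < length gs \<and> o3 < length gs)"

definition clip :: "real \<Rightarrow> real" where "clip t = max 0 (min 1 t)"

definition comp :: "point \<Rightarrow> nat \<Rightarrow> real" where
  "comp x i = (if i = 0 then fst x else if i = 1 then fst (snd x) else snd (snd x))"

text \<open>v is an admissible output value of gate g given input x and gate values vs.
  Comparator gates are nondeterministic on ties.\<close>
fun lgate_ok :: "point \<Rightarrow> real list \<Rightarrow> lgate \<Rightarrow> real \<Rightarrow> bool" where
  "lgate_ok x vs (LIn i) v = (v = comp x i)"
| "lgate_ok x vs (LConst c) v = (v = clip c)"
| "lgate_ok x vs (LAdd a b) v = (v = clip (vs ! a + vs ! b))"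
| "lgate_ok x vs (LSub a b) v = (v = clip (vs ! a - vs ! b))"
| "lgate_ok x vs (LMax a b) v = (v = clip (max (vs ! a) (vs ! b)))"
| "lgate_ok x vs (LMin a b) v = (v = clip (min (vs ! a) (vs ! b)))"
| "lgate_ok x vs (LScale c a) v = (v = clip (c * vs ! a))"
| "lgate_ok x vs (LCmp a b) v =
     ((vs ! a > vs ! b \<longrightarrow> v = 1) \<and> (vs ! a < vs ! b \<longrightarrow> v = 0) \<and> 0 \<le> v \<and> v \<le> 1)"

definition lconsistent :: "lcircuit \<Rightarrow> point \<Rightarrow> real list \<Rightarrow> bool" where
  "lconsistent L x vs = (case L of (gs, _) \<Rightarrow>
     length vs = length gs \<and> (\<forall>k<length gs. lgate_ok x vs (gs ! k) (vs ! k)))"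

definition lout :: "lcircuit \<Rightarrow> real list \<Rightarrow> point" where
  "lout L vs = (case L of (gs, o1, o2, o3) \<Rightarrow> (vs ! o1, vs ! o2, vs ! o3))"

definition lsize :: "lcircuit \<Rightarrow> nat" where "lsize L = length (fst L)"

definition cubeK :: "point set" where
  "cubeK = {0..1} \<times> {0..1} \<times> {0..1}"

definition lcomputes :: "lcircuit \<Rightarrow> (point \<Rightarrow> point) \<Rightarrow> bool" where
  "lcomputes L F = (lcircuit_wf L \<and>
     (\<forall>x\<in>cubeK. (\<exists>vs. lconsistent L x vs) \<and>
                 (\<forall>vs. lconsistent L x vs \<longrightarrow> lout L vs = F x)))"

definition center :: "nat \<Rightarrow> nat \<Rightarrow> nat \<Rightarrow> nat \<Rightarrow> point" where
  "center n i j k = ((real i + 1/2) / 2 ^ n, (real j + 1/2) / 2 ^ n, (real k + 1/2) / 2 ^ n)"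

definition is_center :: "nat \<Rightarrow> point \<Rightarrow> bool" where
  "is_center n z = (\<exists>i<2^n. \<exists>j<2^n. \<exists>k<2^n. z = center n i j k)"

definition delta :: "nat \<Rightarrow> nat \<Rightarrow> point" where
  "delta n c = (let a = 1 / 2 ^ (2 * n) :: real in
     if c = 1 then (a, 0, 0) else if c = 2 then (0, a, 0) else if c = 3 then (0, 0, a)
     else (-a, -a, -a))"

definition linf_dist :: "point \<Rightarrow> point \<Rightarrow> real" where
  "linf_dist x y = max \<bar>fst x - fst y\<bar>
      (max \<bar>fst (snd x) - fst (snd y)\<bar> \<bar>snd (snd x) - snd (snd y)\<bar>)"

definition implements :: "nat \<Rightarrow> (nat \<Rightarrow> nat \<Rightarrow> nat \<Rightarrow> nat) \<Rightarrow> (point \<Rightarrow> point) \<Rightarrow> bool" where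
  "implements n f F =
     ((\<forall>i<2^n. \<forall>j<2^n. \<forall>k<2^n. F (center n i j k) - center n i j k = delta n (f i j k)) \<and>
      (\<forall>x\<in>cubeK. \<not> is_center n x \<longrightarrow>
         F x - x \<in> convex hull {F z - z | z. is_center n z \<and> linf_dist x z \<le> 1 / 2 ^ n}))"

end

theory Submission
  imports Defs
begin

text \<open>
  No comparator is needed. The binary digits of a coordinate are extracted by steep clipped ramps;
  a digit can only be wrong in a narrow slab above a grid plane, and a second family of ramps
  measures a margin that vanishes throughout these slabs. The circuit reads the colours of four
  samples, shifted along the diagonal so that every coordinate spoils at most one of them, and
  averages the displacements of these colours with weights that vanish on the spoilt samples. As
  linear gates can neither multiply nor divide, the weights are assigned greedily (each sample takes
  the minimum of its margin and of the weight that is left), and the product of a weight \<open>w\<close> with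
  a bit \<open>b\<close> is \<open>min w b\<close>, which is harmless if \<open>w = 0\<close> and \<open>b\<close> is garbage.
\<close>

section \<open>Straight-line programs\<close>

text \<open>Exact digit extraction is discontinuous, so any continuous version fails somewhere, and
  its output must be discarded there. Yet everything required of the result is exact: the
  displacement at a centre is \<open>delta\<close> itself, and elsewhere it is a true convex
  combination, so the weights must sum to exactly 1. This is why the margin is a ramp that
  saturates: at most three samples are spoilt, so one of the four has goodness exactly 1, and the
  greedy assignment then uses up the whole unit. In units of the cell width, the spoilt zones have
  radius 1/16 and the shifts are multiples of 1/8 up to 3/8. Two different shifts of one coordinate
  therefore cannot both hit a zone, and a shift starting at a centre stays in its cubelet. A last
  threat is the truncation to [0,1] near the boundary. The prescribed colours of the exterior
  cubelets remove it: closer than alpha to a face, no sample that counts pushes towards that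
  face.\<close>

inductive arith_step :: "(point \<Rightarrow> real) set \<Rightarrow> (point \<Rightarrow> real) \<Rightarrow> bool" for A where
  step_in: "i < 3 \<Longrightarrow> arith_step A (\<lambda>x. comp x i)"
| step_const: "arith_step A (\<lambda>x. clip c)"
| step_add: "f \<in> A \<Longrightarrow> g \<in> A \<Longrightarrow> arith_step A (\<lambda>x. clip (f x + g x))"
| step_sub: "f \<in> A \<Longrightarrow> g \<in> A \<Longrightarrow> arith_step A (\<lambda>x. clip (f x - g x))"
| step_max: "f \<in> A \<Longrightarrow> g \<in> A \<Longrightarrow> arith_step A (\<lambda>x. clip (max (f x) (g x)))"
| step_min: "f \<in> A \<Longrightarrow> g \<in> A \<Longrightarrow> arith_step A (\<lambda>x. clip (min (f x) (g x)))"
| step_scale: "f \<in> A \<Longrightarrow> arith_step A (\<lambda>x. clip (c * f x))"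

text \<open>A program is the list of the functions that its gates compute, so that cost and
  correctness are statements about functions; gate indices are chosen only in
  \<open>arith_step_gate\<close>.\<close>

inductive slp :: "(point \<Rightarrow> real) list \<Rightarrow> bool" where
  slp_Nil: "slp []"
| slp_snoc: "slp fs \<Longrightarrow> arith_step (set fs) f \<Longrightarrow> slp (fs @ [f])"

lemma arith_step_gate:
  assumes "arith_step (set fs) f"
  shows "\<exists>g. lgate_wf (length fs) g \<and> (\<forall>x v. lgate_ok x (map (\<lambda>f. f x) fs) g v \<longleftrightarrow> v = f x)"
  using assms
proof cases
  case (step_in i)
  then show ?thesis by (intro exI[of _ "LIn i"]) auto
next
  case (step_const c)
  then show ?thesis by (intro exI[of _ "LConst c"]) auto
next
  case (step_add g h)
  then obtain a b where "a < length fs" "b < length fs" "fs ! a = g" "fs ! b = h"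
    by (auto simp: in_set_conv_nth)
  with step_add show ?thesis by (intro exI[of _ "LAdd a b"]) auto
next
  case (step_sub g h)
  then obtain a b where "a < length fs" "b < length fs" "fs ! a = g" "fs ! b = h"
    by (auto simp: in_set_conv_nth)
  with step_sub show ?thesis by (intro exI[of _ "LSub a b"]) auto
next
  case (step_max g h)
  then obtain a b where "a < length fs" "b < length fs" "fs ! a = g" "fs ! b = h"
    by (auto simp: in_set_conv_nth)
  with step_max show ?thesis by (intro exI[of _ "LMax a b"]) auto
next
  case (step_min g h)
  then obtain a b where "a < length fs" "b < length fs" "fs ! a = g" "fs ! b = h"
    by (auto simp: in_set_conv_nth)
  with step_min show ?thesis by (intro exI[of _ "LMin a b"]) auto
next
  case (step_scale g c)
  then obtain a where "a < length fs" "fs ! a = g"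
    by (auto simp: in_set_conv_nth)
  with step_scale show ?thesis by (intro exI[of _ "LScale c a"]) auto
qed

text \<open>A gate at position k reads only values before k, so later values cannot influence it.
  This lets a program grow at its end.\<close>

lemma lgate_ok_append:
  assumes "lgate_wf k g" "k \<le> length vs"
  shows "lgate_ok x (vs @ ws) g v \<longleftrightarrow> lgate_ok x vs g v"
  using assms by (cases g) (auto simp: nth_append)

text \<open>Every step is realised by a deterministic gate, so the consistent value list at x exists
  and is unique; \<open>lcomputes\<close> asks for existence and for a common output of all
  consistent runs.\<close>

lemma slp_gates:
  assumes "slp fs"
  shows "\<exists>gs. length gs = length fs \<and> (\<forall>k<length gs. lgate_wf k (gs ! k)) \<and>
    (\<forall>x vs. length vs = length gs \<longrightarrow>
      ((\<forall>k<length gs. lgate_ok x vs (gs ! k) (vs ! k)) \<longleftrightarrow> vs = map (\<lambda>f. f x) fs))"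
  using assms
proof induction
  case slp_Nil
  then show ?case by simp
next
  case (slp_snoc fs f)
  from slp_snoc.IH obtain gs where gs: "length gs = length fs"
    "\<And>k. k < length gs \<Longrightarrow> lgate_wf k (gs ! k)"
    "\<And>x vs. length vs = length gs \<Longrightarrow>
      (\<forall>k<length gs. lgate_ok x vs (gs ! k) (vs ! k)) \<longleftrightarrow> vs = map (\<lambda>f. f x) fs"
    by blast
  from arith_step_gate[OF slp_snoc.hyps(2)] obtain g where g: "lgate_wf (length fs) g"
    "\<And>x v. lgate_ok x (map (\<lambda>f. f x) fs) g v \<longleftrightarrow> v = f x" by blast
  have ok: "(\<forall>k<length (gs @ [g]). lgate_ok x vs ((gs @ [g]) ! k) (vs ! k))
      \<longleftrightarrow> vs = map (\<lambda>f. f x) (fs @ [f])" if "length vs = length (gs @ [g])" for x vs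
  proof -
    from that obtain us v where vs: "vs = us @ [v]" "length us = length gs"
      by (cases vs rule: rev_cases) auto
    have 1: "lgate_ok x (us @ [v]) (gs ! k) ((us @ [v]) ! k) \<longleftrightarrow> lgate_ok x us (gs ! k) (us ! k)"
      if "k < length gs" for k
      using that vs gs(2)[OF that] lgate_ok_append[of k "gs ! k" us] by (simp add: nth_append)
    have 2: "lgate_ok x (us @ [v]) g v \<longleftrightarrow> lgate_ok x us g v"
      using vs gs(1) g(1) by (intro lgate_ok_append) auto
    have "(\<forall>k<length (gs @ [g]). lgate_ok x vs ((gs @ [g]) ! k) (vs ! k)) \<longleftrightarrow>
       (\<forall>k<length gs. lgate_ok x us (gs ! k) (us ! k)) \<and> lgate_ok x us g v"
      using vs 1 2 by (auto simp: nth_append less_Suc_eq)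
    also have "\<dots> \<longleftrightarrow> us = map (\<lambda>f. f x) fs \<and> v = f x"
      using gs(3)[OF vs(2), of x] g(2)[of x v] by blast
    finally show ?thesis using vs gs(1) by auto
  qed
  have "\<forall>k<length (gs @ [g]). lgate_wf k ((gs @ [g]) ! k)"
    using gs g(1) by (auto simp: nth_append less_Suc_eq)
  with ok gs(1) show ?case by (intro exI[of _ "gs @ [g]"]) auto
qed

lemma continuous_on_clip: "continuous_on S f \<Longrightarrow> continuous_on S (\<lambda>x. clip (f x))"
  unfolding clip_def by (intro continuous_intros)

lemma slp_continuous:
  assumes "slp fs" "f \<in> set fs"
  shows "continuous_on S f"
  using assms
proof (induction arbitrary: f)
  case (slp_snoc fs g)
  have "continuous_on S g"
    using slp_snoc.hyps(2)
  proof cases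
    case (step_in i)
    then show ?thesis
      unfolding comp_def by (cases "i = 0"; cases "i = 1") (auto intro!: continuous_intros)
  qed (simp; intro continuous_on_clip continuous_intros slp_snoc.IH; assumption)+
  with slp_snoc show ?case by auto
qed auto

lemma slp_lcircuit:
  assumes "slp fs" "f \<in> set fs" "g \<in> set fs" "h \<in> set fs"
  shows "\<exists>L. lcomputes L (\<lambda>x. (f x, g x, h x)) \<and> lsize L = length fs"
proof -
  from slp_gates[OF assms(1)] obtain gs where gs: "length gs = length fs"
    "\<And>k. k < length gs \<Longrightarrow> lgate_wf k (gs ! k)"
    "\<And>x vs. length vs = length gs \<Longrightarrow>
      (\<forall>k<length gs. lgate_ok x vs (gs ! k) (vs ! k)) \<longleftrightarrow> vs = map (\<lambda>f. f x) fs"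
    by blast
  obtain a b c where abc: "a < length fs" "b < length fs" "c < length fs"
    "fs ! a = f" "fs ! b = g" "fs ! c = h"
    using assms by (auto simp: in_set_conv_nth)
  define L :: lcircuit where "L = (gs, a, b, c)"
  have con: "lconsistent L x vs \<longleftrightarrow> vs = map (\<lambda>f. f x) fs" for x vs
    using gs(1) gs(3)[of vs x] unfolding lconsistent_def L_def by auto
  have "lcomputes L (\<lambda>x. (f x, g x, h x))"
    unfolding lcomputes_def con using gs abc
    by (auto simp: lcircuit_wf_def L_def lout_def)
  moreover have "lsize L = length fs" using gs by (simp add: L_def lsize_def)
  ultimately show ?thesis by blast
qed

text \<open>A cost judgement relative to any program that already contains A. Quantifying over all
  such programs makes costs additive under composition and gives reuse of a finished function at
  cost 0, with no gate indices to track.\<close>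

definition computable_from :: "nat \<Rightarrow> (point \<Rightarrow> real) set \<Rightarrow> (point \<Rightarrow> real) set \<Rightarrow> bool" where
  "computable_from k A B \<longleftrightarrow> (\<forall>fs. slp fs \<and> A \<subseteq> set fs \<longrightarrow>
     (\<exists>hs. slp (fs @ hs) \<and> length hs \<le> k \<and> B \<subseteq> set (fs @ hs)))"

lemma computable_fromE:
  assumes "computable_from k A B" "slp fs" "A \<subseteq> set fs"
  obtains hs where "slp (fs @ hs)" "length hs \<le> k" "B \<subseteq> set (fs @ hs)"
  using assms unfolding computable_from_def by blast

lemma computable_from_mono:
  assumes "computable_from k A B" "k \<le> k'" "A \<subseteq> A'" "B' \<subseteq> B"
  shows "computable_from k' A' B'"
  using assms unfolding computable_from_def by (meson order_trans)

lemma computable_from_weaken: "computable_from k A B \<Longrightarrow> k \<le> k' \<Longrightarrow> computable_from k' A B"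
  by (rule computable_from_mono) auto

lemma computable_from_subset: "B \<subseteq> A \<Longrightarrow> computable_from 0 A B"
  unfolding computable_from_def by (metis append.right_neutral le_zero_eq list.size(3) order_trans)

lemma computable_from_mem: "f \<in> A \<Longrightarrow> computable_from 0 A {f}"
  by (rule computable_from_subset) auto

lemma computable_from_trans:
  assumes "computable_from k A B" "computable_from l (A \<union> B) C"
  shows "computable_from (k + l) A (B \<union> C)"
  unfolding computable_from_def
proof safe
  fix fs assume fs: "slp fs" "A \<subseteq> set fs"
  obtain hs where hs: "slp (fs @ hs)" "length hs \<le> k" "B \<subseteq> set (fs @ hs)"
    using computable_fromE[OF assms(1) fs] .
  then have "A \<union> B \<subseteq> set (fs @ hs)" using fs by auto
  from computable_fromE[OF assms(2) hs(1) this] obtain ks where ks: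
    "slp ((fs @ hs) @ ks)" "length ks \<le> l" "C \<subseteq> set ((fs @ hs) @ ks)" .
  show "\<exists>hs. slp (fs @ hs) \<and> length hs \<le> k + l \<and> B \<union> C \<subseteq> set (fs @ hs)"
    using hs ks by (intro exI[of _ "hs @ ks"]) auto
qed

lemma computable_from_Un:
  assumes "computable_from k A B" "computable_from l A C"
  shows "computable_from (k + l) A (B \<union> C)"
  using assms(1) by (rule computable_from_trans) (rule computable_from_mono[OF assms(2)], auto)

lemma computable_from_UN:
  assumes "\<And>i. i < (m::nat) \<Longrightarrow> computable_from k A (B i)"
  shows "computable_from (m * k) A (\<Union>i<m. B i)"
  using assms
proof (induction m)
  case 0
  then show ?case by (simp add: computable_from_subset)
next
  case (Suc m)
  have "computable_from (m * k + k) A ((\<Union>i<m. B i) \<union> B m)"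
    using Suc by (intro computable_from_Un) auto
  then show ?case by (simp add: lessThan_Suc Un_commute add.commute)
qed

text \<open>The second premise ranges over all supersets of B because the extended program contains
  further functions besides those in B.\<close>

lemma computable_from_step:
  assumes "computable_from k A B" "\<And>C. B \<subseteq> C \<Longrightarrow> arith_step C f"
  shows "computable_from (Suc k) A {f}"
  unfolding computable_from_def
proof safe
  fix fs assume fs: "slp fs" "A \<subseteq> set fs"
  obtain hs where hs: "slp (fs @ hs)" "length hs \<le> k" "B \<subseteq> set (fs @ hs)"
    using computable_fromE[OF assms(1) fs] .
  then show "\<exists>hs. slp (fs @ hs) \<and> length hs \<le> Suc k \<and> {f} \<subseteq> set (fs @ hs)"
    using slp_snoc[OF hs(1) assms(2)] by (intro exI[of _ "hs @ [f]"]) auto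
qed

lemma computable_from_comp: "i < 3 \<Longrightarrow> computable_from 1 A {\<lambda>x. comp x i}"
  using computable_from_step[OF computable_from_subset[of "{}"] step_in] by simp

lemma clip_id: "0 \<le> t \<Longrightarrow> t \<le> 1 \<Longrightarrow> clip t = t"
  by (simp add: clip_def)

lemma clip_ge_0 [simp]: "0 \<le> clip t" and clip_le_1 [simp]: "clip t \<le> 1"
  by (auto simp: clip_def)

lemma computable_from_const: "0 \<le> c \<Longrightarrow> c \<le> 1 \<Longrightarrow> computable_from 1 A {\<lambda>x. c}"
  using computable_from_step[OF computable_from_subset[of "{}"] step_const, of A c]
  by (simp add: clip_id)

lemma
  assumes "computable_from k A {f}" "computable_from l A {g}"
  shows computable_from_add: "computable_from (k + l + 1) A {\<lambda>x. clip (f x + g x)}"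
    and computable_from_sub: "computable_from (k + l + 1) A {\<lambda>x. clip (f x - g x)}"
    and computable_from_max: "computable_from (k + l + 1) A {\<lambda>x. clip (max (f x) (g x))}"
    and computable_from_min: "computable_from (k + l + 1) A {\<lambda>x. clip (min (f x) (g x))}"
  using computable_from_Un[OF assms]
  by (auto elim!: computable_from_step intro!: arith_step.intros)

lemma computable_from_scale:
  "computable_from k A {f} \<Longrightarrow> computable_from (k + 1) A {\<lambda>x. clip (c * f x)}"
  by (auto elim!: computable_from_step intro!: arith_step.intros)

lemma computable_from_lcircuit:
  assumes "computable_from k {} {f, g, h}"
  shows "\<exists>L. lcomputes L (\<lambda>x. (f x, g x, h x)) \<and> continuous_on cubeK (\<lambda>x. (f x, g x, h x)) \<and>
    lsize L \<le> k"
proof -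
  from computable_fromE[OF assms slp_Nil] obtain fs where
    fs: "slp fs" "length fs \<le> k" "{f, g, h} \<subseteq> set fs" by auto
  then have "continuous_on cubeK (\<lambda>x. (f x, g x, h x))"
    by (intro continuous_on_Pair) (auto intro: slp_continuous)
  moreover obtain L where "lcomputes L (\<lambda>x. (f x, g x, h x))" "lsize L = length fs"
    using slp_lcircuit[OF fs(1), of f g h] fs(3) by blast
  ultimately show ?thesis using fs(2) by (intro exI[of _ L]) simp
qed

section \<open>Binary expansion by steep ramps\<close>

text \<open>The truncation of the subtraction gate makes the kink at 1/2. The ramp is 0 up to 1/2,
  reaches 1 at 1/2 + 1/(32*2^n), and is meaningless in between.\<close>

definition digit :: "nat \<Rightarrow> real \<Rightarrow> real" where
  "digit n r = clip (32 * 2 ^ n * clip (r - 1 / 2))"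

text \<open>The second ramp starts where that of \<open>digit\<close> ends, so the margin is 0
  wherever \<open>digit\<close> is neither 0 nor 1. Both ramps have reached 1 at distance 1/(16*2^n)
  from 1/2.\<close>

definition margin :: "nat \<Rightarrow> real \<Rightarrow> real" where
  "margin n r = clip (max (clip (32 * 2 ^ n * clip (1 / 2 - r)))
     (clip (32 * 2 ^ n * clip (r - (1 / 2 + 1 / (32 * 2 ^ n))))))"

text \<open>The doubling map of binary expansion, with \<open>digit\<close> in the role of the
  leading bit; each \<open>clip\<close> is the truncation of one gate.\<close>

primrec residue :: "nat \<Rightarrow> nat \<Rightarrow> real \<Rightarrow> real" where
  "residue n 0 y = y"
| "residue n (Suc t) y =
     clip (2 * clip (residue n t y - clip (1 / 2 * digit n (residue n t y))))"

primrec margins :: "nat \<Rightarrow> nat \<Rightarrow> real \<Rightarrow> real" where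
  "margins n 0 y = 1"
| "margins n (Suc t) y = clip (min (margins n t y) (margin n (residue n t y)))"

text \<open>The bits are read by the sharp test against 1/2 instead of by the ramp, so this is a
  natural number for every y. It locates y on the grid only where the margins are positive.\<close>

primrec index :: "nat \<Rightarrow> nat \<Rightarrow> real \<Rightarrow> nat" where
  "index n 0 y = 0"
| "index n (Suc t) y = 2 * index n t y + of_bool (residue n t y > 1 / 2)"

lemma digit_exact:
  assumes "margin n r > 0"
  shows "digit n r = of_bool (r > 1 / 2)"
proof -
  define M :: real where "M = 32 * 2 ^ n"
  have M: "M > 0" by (simp add: M_def)
  show ?thesis
  proof (cases "r \<le> 1 / 2")
    case True
    then show ?thesis by (simp add: digit_def clip_def)
  next
    case False
    then have "clip (1 / 2 - r) = 0" by (simp add: clip_def)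
    with assms have "clip (M * clip (r - (1 / 2 + 1 / M))) > 0"
      by (auto simp: margin_def M_def clip_def split: if_splits)
    then have "r - (1 / 2 + 1 / M) > 0"
      using M by (auto simp: clip_def zero_less_mult_iff less_max_iff_disj)
    then have "r - 1 / 2 > 1 / M" by simp
    then have "M * (r - 1 / 2) > 1" using M by (simp add: field_simps)
    moreover have "M \<ge> 1" unfolding M_def using one_le_power[of "2::real" n] by linarith
    ultimately have "M * clip (r - 1 / 2) \<ge> 1"
      using False by (auto simp: clip_def min_def)
    then have "digit n r = 1" by (simp add: digit_def M_def clip_def)
    with False show ?thesis by simp
  qed
qed

text \<open>A positive minimum of the margins makes each of the T digits exact, so no error enters a
  later stage. Each residue r is then followed by 2r or by 2r - 1, which stays in [0,1], so that no
  \<open>clip\<close> acts.\<close>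

lemma residue_correct:
  assumes "0 \<le> y" "y \<le> 1" "margins n T y > 0"
  shows "residue n T y = 2 ^ T * y - index n T y \<and> 0 \<le> residue n T y \<and> residue n T y \<le> 1 \<and>
    (\<forall>t<T. digit n (residue n t y) = of_bool (residue n t y > 1 / 2))"
  using assms(3)
proof (induction T)
  case 0
  then show ?case using assms by simp
next
  case (Suc T)
  from Suc.prems have pos: "margins n T y > 0" "margin n (residue n T y) > 0"
    by (auto simp: clip_def split: if_splits)
  note IH = Suc.IH[OF pos(1)]
  define r where "r = residue n T y"
  have d: "digit n r = of_bool (r > 1 / 2)"
    using digit_exact pos(2) by (simp add: r_def)
  have "residue n (Suc T) y = 2 * r - of_bool (r > 1 / 2)"
    using IH d by (auto simp: r_def[symmetric] clip_def)
  with IH d show ?case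
    by (auto simp: r_def[symmetric] less_Suc_eq algebra_simps)
qed

lemma index_less: "index n T y < 2 ^ T"
  by (induction T) auto

text \<open>Each stage doubles the index and adds a bit, and integer division undoes these stages
  one by one. It links \<open>nbit\<close>, counted from the low end, to the residues, counted from
  the top.\<close>

lemma index_div:
  assumes "t \<le> T"
  shows "index n T y div 2 ^ (T - t) = index n t y"
  using assms
proof (induction rule: dec_induct)
  case (step T)
  have "index n (Suc T) y div 2 ^ (Suc T - t) = index n (Suc T) y div 2 div 2 ^ (T - t)"
    using step by (simp add: Suc_diff_le div_mult2_eq)
  also have "index n (Suc T) y div 2 = index n T y" by simp
  finally show ?case using step by simp
qed simp

lemma nbit_index:
  assumes "t < T"
  shows "nbit (index n T y) t \<longleftrightarrow> residue n (T - 1 - t) y > 1 / 2"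
proof -
  have "index n T y div 2 ^ t = index n (Suc (T - 1 - t)) y"
    using index_div[of "Suc (T - 1 - t)" T n y] assms by simp
  then show ?thesis by (simp add: nbit_def)
qed

lemma index_eq_0: "index n T y = 0 \<longleftrightarrow> (\<forall>t<T. \<not> residue n t y > 1 / 2)"
  by (induction T) (auto simp: less_Suc_eq)

text \<open>Together with \<open>index_eq_0\<close> this turns the two kinds of face test into a
  conjunction and a disjunction of digits.\<close>

lemma index_eq_max: "index n T y = 2 ^ T - 1 \<longleftrightarrow> (\<forall>t<T. residue n t y > 1 / 2)"
proof (induction T)
  case (Suc T)
  have "index n (Suc T) y = 2 ^ Suc T - 1 \<longleftrightarrow> index n T y = 2 ^ T - 1 \<and> residue n T y > 1 / 2"
  proof -
    obtain m :: nat where "2 ^ T = Suc m"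
      by (metis Suc_pred zero_less_numeral zero_less_power)
    then show ?thesis by (cases "residue n T y > 1 / 2") (simp_all, arith+)
  qed
  with Suc show ?case by (auto simp: less_Suc_eq)
qed simp

lemma index_bounds:
  assumes "0 \<le> y" "y \<le> 1" "margins n n y > 0"
  shows "index n n y / 2 ^ n \<le> y" "y \<le> (index n n y + 1) / 2 ^ n"
  using residue_correct[OF assms] by (auto simp: field_simps)

lemma margin_eq_1:
  assumes "\<bar>r - 1 / 2\<bar> \<ge> 1 / (16 * 2 ^ n)"
  shows "margin n r = 1"
proof -
  define M :: real where "M = 32 * 2 ^ n"
  have M: "M \<ge> 1" unfolding M_def using one_le_power[of "2::real" n] by linarith
  have a: "\<bar>r - 1 / 2\<bar> \<ge> 2 / M" using assms by (simp add: M_def)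
  have ramp: "clip (M * clip u) = 1" if "u \<ge> 1 / M" for u
  proof -
    have "0 < 1 / M" using M by simp
    with that have "0 < u" by linarith
    moreover have "M * u \<ge> 1" using that M by (simp add: field_simps)
    ultimately show ?thesis using M by (auto simp: clip_def min_def)
  qed
  have "clip (M * clip (1 / 2 - r)) = 1 \<or> clip (M * clip (r - (1 / 2 + 1 / M))) = 1"
  proof (cases "r \<le> 1 / 2")
    case True
    with a have "1 / 2 - r \<ge> 2 / M" by simp
    moreover have "2 / M \<ge> 1 / M" using M by (simp add: field_simps)
    ultimately show ?thesis using ramp by simp
  next
    case False
    with a have "r - 1 / 2 \<ge> 2 / M" by simp
    then show ?thesis using ramp by (simp add: field_simps)
  qed
  moreover have "max (clip u) (clip v) = 1" if "clip u = 1 \<or> clip v = 1" for u v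
    using that clip_le_1[of u] clip_le_1[of v] by (auto simp: max_def simp del: clip_le_1)
  ultimately have "max (clip (M * clip (1 / 2 - r))) (clip (M * clip (r - (1 / 2 + 1 / M)))) = 1"
    by blast
  moreover have "margin n r =
      clip (max (clip (M * clip (1 / 2 - r))) (clip (M * clip (r - (1 / 2 + 1 / M)))))"
    by (simp only: margin_def M_def)
  ultimately show ?thesis by (simp add: clip_id)
qed

text \<open>Stage T compares y with an odd multiple of 1/2^(T+1), an interior grid point, and
  doubling only magnifies the distance to it. Hence a gap that suffices for the first stage suffices
  for all.\<close>

lemma margins_eq_1:
  assumes "0 \<le> y" "y \<le> 1" "T \<le> n"
    and sep: "\<And>j. 0 < j \<Longrightarrow> j < 2 ^ n \<Longrightarrow> \<bar>y - real j / 2 ^ n\<bar> \<ge> 1 / (16 * 2 ^ n)"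
  shows "margins n T y = 1"
  using assms(3)
proof (induction T)
  case (Suc T)
  then have one: "margins n T y = 1" by simp
  have res: "residue n T y = 2 ^ T * y - index n T y"
    using residue_correct[OF assms(1,2), of n T] one by simp
  \<comment> \<open>The grid point j / 2^n is the midpoint of the current dyadic interval, where the
    residue equals 1/2.\<close>
  define j where "j = (2 * index n T y + 1) * 2 ^ (n - T - 1)"
  have pow: "(2::nat) ^ n = 2 ^ Suc T * 2 ^ (n - T - 1)"
    unfolding power_add[symmetric] using Suc.prems by (intro arg_cong[where f = "power 2"]) simp
  have "0 < j" by (simp add: j_def)
  moreover have "j < 2 ^ n"
    unfolding j_def pow using index_less[of n T y] by (intro mult_strict_right_mono) auto
  ultimately have s: "\<bar>y - real j / 2 ^ n\<bar> \<ge> 1 / (16 * 2 ^ n)" by (rule sep)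
  have powr: "(2::real) ^ n = 2 ^ Suc T * 2 ^ (n - T - 1)"
    unfolding power_add[symmetric] using Suc.prems by (intro arg_cong[where f = "power 2"]) simp
  have "real j = real (2 * index n T y + 1) * 2 ^ (n - T - 1)"
    by (simp only: j_def of_nat_mult of_nat_power of_nat_numeral)
  then have "real j / 2 ^ n = real (2 * index n T y + 1) / 2 ^ Suc T"
    unfolding powr by (simp only: mult_divide_mult_cancel_right[OF power_not_zero[OF zero_neq_numeral[symmetric]]])
  then have "residue n T y - 1 / 2 = 2 ^ T * (y - real j / 2 ^ n)"
    unfolding res by (simp add: field_simps)
  then have "\<bar>residue n T y - 1 / 2\<bar> = 2 ^ T * \<bar>y - real j / 2 ^ n\<bar>"
    by (simp add: abs_mult)
  moreover have "2 ^ T * \<bar>y - real j / 2 ^ n\<bar> \<ge> 1 * \<bar>y - real j / 2 ^ n\<bar>"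
    by (intro mult_right_mono) auto
  ultimately have "margin n (residue n T y) = 1"
    using order_trans[OF s] by (intro margin_eq_1) simp
  with one show ?case by (simp add: clip_def)
qed simp

section \<open>Gate counts for residues, digits and margins\<close>

lemma computable_from_trans':
  assumes "computable_from k A B" "computable_from l (A \<union> B) C"
  shows "computable_from (k + l) A C"
  using computable_from_trans[OF assms] by (rule computable_from_mono) auto

lemmas computable_from_gate = computable_from_add computable_from_sub computable_from_max
  computable_from_min computable_from_scale

lemma computable_from_residue:
  assumes "f \<in> A"
  shows "computable_from (6 * T) A ((\<lambda>t x. residue n t (f x)) ` {..T})"
proof (induction T)
  case 0
  show ?case using assms by (simp add: computable_from_mem)
next
  case (Suc T)
  let ?B = "(\<lambda>t x. residue n t (f x)) ` {..T}"
  have "computable_from 6 {\<lambda>x. residue n T (f x)} {\<lambda>x. residue n (Suc T) (f x)}"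
    unfolding residue.simps digit_def
    by (rule computable_from_weaken,
      (rule computable_from_gate | (rule computable_from_const; simp) | (rule computable_from_mem, simp))+)
      simp
  then have "computable_from 6 (A \<union> ?B) {\<lambda>x. residue n (Suc T) (f x)}"
    by (rule computable_from_mono) auto
  from computable_from_trans[OF Suc this] show ?case
    by (simp add: atMost_Suc insert_commute Un_insert_right add.commute del: residue.simps)
qed


lemma computable_from_digits:
  assumes "f \<in> A"
  shows "computable_from (17 * n + 1) A
    (insert (\<lambda>x. margins n n (f x)) ((\<lambda>t x. digit n (residue n t (f x))) ` {..<n}))"
proof -
  let ?R = "(\<lambda>t x. residue n t (f x)) ` {..n}"
  let ?D = "(\<lambda>t x. digit n (residue n t (f x))) ` {..<n}"
  have "computable_from 3 (A \<union> ?R) {\<lambda>x. digit n (residue n t (f x))}" if "t < n" for t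
    unfolding digit_def
    by (rule computable_from_weaken, (rule computable_from_gate | (rule computable_from_const; simp)
        | (rule computable_from_mem, use that in simp))+)
      simp
  then have D: "computable_from (n * 3) (A \<union> ?R) ?D"
    using computable_from_UN[of n 3 "A \<union> ?R" "\<lambda>t. {\<lambda>x. digit n (residue n t (f x))}"]
    by (simp add: UNION_singleton_eq_range)
  have "computable_from (8 * T + 1) (A \<union> ?R) {\<lambda>x. margins n T (f x)}" if "T \<le> n" for T
    using that
  proof (induction T)
    case 0
    then show ?case by (simp add: computable_from_const[simplified])
  next
    case (Suc T)
    have c: "1 / 2 + 1 / (32 * 2 ^ n) \<le> (1::real)"
      by (simp add: field_simps) (use one_le_power[of "2::real" n] in linarith)
    have "computable_from 7 (A \<union> ?R) {\<lambda>x. margin n (residue n T (f x))}"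
      unfolding margin_def
      by (rule computable_from_weaken, (rule computable_from_gate
          | (rule computable_from_const; use c in simp) | (rule computable_from_mem, use Suc.prems in simp))+)
        simp
    from computable_from_min[OF Suc.IH this] Suc.prems show ?case
      by (simp add: computable_from_weaken)
  qed
  from computable_from_Un[OF this[OF order_refl] D]
  have "computable_from (11 * n + 1) (A \<union> ?R) (insert (\<lambda>x. margins n n (f x)) ?D)"
    by (simp add: algebra_simps)
  from computable_from_trans'[OF computable_from_residue[OF assms] this] show ?thesis
    by (simp add: algebra_simps)
qed

section \<open>Boolean functions as arithmetic functions\<close>

definition arith_not :: "real \<Rightarrow> real" where "arith_not a = clip (1 - a)"
definition arith_and :: "real \<Rightarrow> real \<Rightarrow> real" where "arith_and a b = clip (min a b)"
definition arith_or :: "real \<Rightarrow> real \<Rightarrow> real" where "arith_or a b = clip (max a b)"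

lemma arith_not_of_bool [simp]: "arith_not (of_bool p) = of_bool (\<not> p)"
  and arith_and_of_bool [simp]: "arith_and (of_bool p) (of_bool q) = of_bool (p \<and> q)"
  and arith_or_of_bool [simp]: "arith_or (of_bool p) (of_bool q) = of_bool (p \<or> q)"
  by (auto simp: arith_not_def arith_and_def arith_or_def clip_def)

lemma computable_from_not:
  "computable_from k A {f} \<Longrightarrow> computable_from (1 + k + 1) A {\<lambda>x. arith_not (f x)}"
  unfolding arith_not_def by (intro computable_from_sub computable_from_const) auto

lemma
  assumes "computable_from k A {f}" "computable_from l A {g}"
  shows computable_from_and: "computable_from (k + l + 1) A {\<lambda>x. arith_and (f x) (g x)}"
    and computable_from_or: "computable_from (k + l + 1) A {\<lambda>x. arith_or (f x) (g x)}"
  unfolding arith_and_def arith_or_def using assms by (rule computable_from_min computable_from_max)+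

primrec arith_ex :: "(nat \<Rightarrow> real) \<Rightarrow> nat \<Rightarrow> real" where
  "arith_ex f 0 = 0"
| "arith_ex f (Suc t) = arith_or (arith_ex f t) (f t)"

primrec arith_all :: "(nat \<Rightarrow> real) \<Rightarrow> nat \<Rightarrow> real" where
  "arith_all f 0 = 1"
| "arith_all f (Suc t) = arith_and (arith_all f t) (f t)"

lemma arith_ex_of_bool: "(\<And>t. t < T \<Longrightarrow> f t = of_bool (P t)) \<Longrightarrow> arith_ex f T = of_bool (\<exists>t<T. P t)"
proof (induction T)
  case (Suc T)
  then have "arith_ex f (Suc T) = of_bool ((\<exists>t<T. P t) \<or> P T)" by simp
  then show ?case by (simp add: less_Suc_eq ex_disj_distrib conj_disj_distribR disj_commute)
qed simp

lemma arith_all_of_bool: "(\<And>t. t < T \<Longrightarrow> f t = of_bool (P t)) \<Longrightarrow> arith_all f T = of_bool (\<forall>t<T. P t)"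
proof (induction T)
  case (Suc T)
  then have "arith_all f (Suc T) = of_bool ((\<forall>t<T. P t) \<and> P T)" by simp
  then show ?case by (simp add: less_Suc_eq all_conj_distrib imp_conjL conj_commute)
qed simp

lemma computable_from_ex:
  "(\<And>t. t < T \<Longrightarrow> f t \<in> A) \<Longrightarrow> computable_from (T + 1) A {\<lambda>x. arith_ex (\<lambda>t. f t x) T}"
proof (induction T)
  case (Suc T)
  then have "computable_from (T + 1 + 0 + 1) A {\<lambda>x. arith_or (arith_ex (\<lambda>t. f t x) T) (f T x)}"
    by (intro computable_from_or computable_from_mem) auto
  then show ?case by simp
qed (simp add: computable_from_const[simplified])

lemma computable_from_all:
  "(\<And>t. t < T \<Longrightarrow> f t \<in> A) \<Longrightarrow> computable_from (T + 1) A {\<lambda>x. arith_all (\<lambda>t. f t x) T}"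
proof (induction T)
  case (Suc T)
  then have "computable_from (T + 1 + 0 + 1) A {\<lambda>x. arith_and (arith_all (\<lambda>t. f t x) T) (f T x)}"
    by (intro computable_from_and computable_from_mem) auto
  then show ?case by simp
qed (simp add: computable_from_const[simplified])

section \<open>Arithmetic simulation of a Boolean circuit\<close>

fun arith_gate :: "(nat \<Rightarrow> real) \<Rightarrow> real list \<Rightarrow> bgate \<Rightarrow> real" where
  "arith_gate x vs (BIn i) = x i"
| "arith_gate x vs (BConst b) = of_bool b"
| "arith_gate x vs (BNot a) = arith_not (vs ! a)"
| "arith_gate x vs (BAnd a b) = arith_and (vs ! a) (vs ! b)"
| "arith_gate x vs (BOr a b) = arith_or (vs ! a) (vs ! b)"

definition arith_vals :: "(nat \<Rightarrow> real) \<Rightarrow> bgate list \<Rightarrow> real list" where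
  "arith_vals x gs = foldl (\<lambda>vs g. vs @ [arith_gate x vs g]) [] gs"

lemma arith_vals_snoc: "arith_vals x (gs @ [g]) = arith_vals x gs @ [arith_gate x (arith_vals x gs) g]"
  by (simp add: arith_vals_def)

lemma arith_vals_Nil [simp]: "arith_vals x [] = []"
  by (simp add: arith_vals_def)

lemma length_arith_vals [simp]: "length (arith_vals x gs) = length gs"
  by (induction gs rule: rev_induct) (simp_all add: arith_vals_snoc)

lemma bvals_snoc: "bvals x (gs @ [g]) = bvals x gs @ [bgate_eval x (bvals x gs) g]"
  by (simp add: bvals_def)

lemma length_bvals [simp]: "length (bvals x gs) = length gs"
  by (induction gs rule: rev_induct) (simp_all add: bvals_snoc bvals_def[of _ "[]"])

lemma bgates_wf_snocD:
  assumes "\<forall>k<length (gs @ [g]). bgate_wf m k ((gs @ [g]) ! k)"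
  shows "\<forall>k<length gs. bgate_wf m k (gs ! k)" "bgate_wf m (length gs) g"
proof -
  show "\<forall>k<length gs. bgate_wf m k (gs ! k)"
  proof (intro allI impI)
    fix k assume "k < length gs"
    with spec[OF assms, of k] show "bgate_wf m k (gs ! k)" by (simp add: nth_append)
  qed
  show "bgate_wf m (length gs) g" using spec[OF assms, of "length gs"] by simp
qed

lemma arith_vals_of_bool:
  assumes "\<forall>k<length gs. bgate_wf m k (gs ! k)" "\<And>i. i < m \<Longrightarrow> x i = of_bool (X i)"
  shows "arith_vals x gs = map of_bool (bvals X gs)"
  using assms(1)
proof (induction gs rule: rev_induct)
  case Nil
  then show ?case by (simp add: bvals_def)
next
  case (snoc g gs)
  note wf = bgates_wf_snocD[OF snoc.prems]
  have "arith_gate x (map of_bool (bvals X gs)) g = of_bool (bgate_eval X (bvals X gs) g)"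
    using wf(2) assms(2) by (cases g) auto
  with snoc.IH[OF wf(1)] show ?case by (simp add: arith_vals_snoc bvals_snoc)
qed

lemma computable_from_arith_vals:
  assumes "\<forall>k<length gs. bgate_wf m k (gs ! k)" "\<And>i. i < m \<Longrightarrow> (\<lambda>x. b x i) \<in> A"
  shows "computable_from (2 * length gs) A ((\<lambda>k x. arith_vals (b x) gs ! k) ` {..<length gs})"
  using assms(1)
proof (induction gs rule: rev_induct)
  case Nil
  then show ?case by (simp add: computable_from_subset)
next
  case (snoc g gs)
  note wf = bgates_wf_snocD[OF snoc.prems]
  let ?V = "(\<lambda>k x. arith_vals (b x) gs ! k) ` {..<length gs}"
  \<comment> \<open>Negation is the most expensive case: it needs the constant 1 and a
    subtraction.\<close>
  have "computable_from 2 (A \<union> ?V) {\<lambda>x. arith_gate (b x) (arith_vals (b x) gs) g}"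
  proof (cases g)
    case (BIn i)
    then show ?thesis using assms(2) wf(2)
      by (auto intro!: computable_from_weaken[OF computable_from_mem])
  next
    case (BConst c)
    then show ?thesis by (auto intro!: computable_from_weaken[OF computable_from_const])
  next
    case (BNot a)
    then show ?thesis using wf(2)
      by (auto intro!: computable_from_weaken[OF computable_from_not[OF computable_from_mem]])
  next
    case (BAnd c d)
    then show ?thesis using wf(2)
      by (auto intro!: computable_from_weaken[OF computable_from_and[OF computable_from_mem computable_from_mem]])
  next
    case (BOr c d)
    then show ?thesis using wf(2)
      by (auto intro!: computable_from_weaken[OF computable_from_or[OF computable_from_mem computable_from_mem]])
  qed
  from computable_from_trans[OF snoc.IH[OF wf(1)] this]
  have "computable_from (2 * length gs + 2) A
    (insert (\<lambda>x. arith_gate (b x) (arith_vals (b x) gs) g) ?V)" by simp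
  moreover have "(\<lambda>k x. arith_vals (b x) (gs @ [g]) ! k) ` {..<length gs} = ?V"
    by (rule image_cong) (auto simp: arith_vals_snoc nth_append)
  ultimately show ?case by (simp add: lessThan_Suc arith_vals_snoc nth_append)
qed

section \<open>The colour of a sample\<close>

text \<open>The residues produce the most significant digit first, whereas \<open>nbit\<close> counts from the least
  significant one.\<close>

definition input_digit :: "nat \<Rightarrow> real \<Rightarrow> real \<Rightarrow> real \<Rightarrow> nat \<Rightarrow> real" where
  "input_digit n p q r t =
     (if t < n then digit n (residue n (n - 1 - t) p)
      else if t < 2 * n then digit n (residue n (n - 1 - (t - n)) q)
      else digit n (residue n (n - 1 - (t - 2 * n)) r))"

definition nonzero_index :: "nat \<Rightarrow> real \<Rightarrow> real" where
  "nonzero_index n y = arith_ex (\<lambda>t. digit n (residue n t y)) n"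

definition max_index :: "nat \<Rightarrow> real \<Rightarrow> real" where
  "max_index n y = arith_all (\<lambda>t. digit n (residue n t y)) n"

definition circuit_bit :: "nat \<Rightarrow> bcircuit \<Rightarrow> real \<Rightarrow> real \<Rightarrow> real \<Rightarrow> nat \<Rightarrow> real" where
  "circuit_bit n C p q r o1 = arith_vals (input_digit n p q r) (fst C) ! o1"

definition max_face :: "nat \<Rightarrow> real \<Rightarrow> real \<Rightarrow> real \<Rightarrow> real" where
  "max_face n p q r = arith_or (arith_or (max_index n p) (max_index n q)) (max_index n r)"

definition no_zero_face :: "nat \<Rightarrow> real \<Rightarrow> real \<Rightarrow> real \<Rightarrow> real" where
  "no_zero_face n p q r =
     arith_and (arith_and (nonzero_index n p) (nonzero_index n q)) (nonzero_index n r)"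

definition inner_colour :: "nat \<Rightarrow> bcircuit \<Rightarrow> real \<Rightarrow> real \<Rightarrow> real \<Rightarrow> nat \<Rightarrow> real" where
  "inner_colour n C p q r c =
     (let b1 = circuit_bit n C p q r (fst (snd C)); b0 = circuit_bit n C p q r (snd (snd C))
      in arith_and (if c \<in> {2, 3} then b1 else arith_not b1) (if c \<in> {1, 3} then b0 else arith_not b0))"

text \<open>The branches of \<open>brouwer_fun\<close> are made mutually exclusive by repeating the
  tests of the earlier ones; \<open>u\<close> is the branch that consults the circuit.\<close>

definition selector :: "nat \<Rightarrow> bcircuit \<Rightarrow> real \<Rightarrow> real \<Rightarrow> real \<Rightarrow> nat \<Rightarrow> real" where
  "selector n C p q r c =
     (let u = arith_and (no_zero_face n p q r) (arith_and (arith_not (max_face n p q r)) (inner_colour n C p q r c))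
      in if c = 1 then arith_or (arith_not (nonzero_index n p)) u
         else if c = 2 then arith_or (arith_and (nonzero_index n p) (arith_not (nonzero_index n q))) u
         else if c = 3 then
           arith_or (arith_and (arith_and (nonzero_index n p) (nonzero_index n q)) (arith_not (nonzero_index n r))) u
         else arith_or (arith_and (no_zero_face n p q r) (max_face n p q r)) u)"

lemma nonzero_index_correct:
  assumes "0 \<le> y" "y \<le> 1" "margins n n y > 0"
  shows "nonzero_index n y = of_bool (index n n y \<noteq> 0)"
  unfolding nonzero_index_def index_eq_0 using residue_correct[OF assms]
  by (subst arith_ex_of_bool[where P = "\<lambda>t. residue n t y > 1 / 2"]) auto

lemma max_index_correct:
  assumes "0 \<le> y" "y \<le> 1" "margins n n y > 0"
  shows "max_index n y = of_bool (index n n y = 2 ^ n - 1)"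
  unfolding max_index_def index_eq_max using residue_correct[OF assms]
  by (subst arith_all_of_bool[where P = "\<lambda>t. residue n t y > 1 / 2"]) auto

lemma digit_nbit:
  assumes "0 \<le> y" "y \<le> 1" "margins n n y > 0" "t < n"
  shows "digit n (residue n (n - 1 - t) y) = of_bool (nbit (index n n y) t)"
  using residue_correct[OF assms(1-3)] assms(4) nbit_index[OF assms(4), of n y] by simp

lemma selector_correct:
  assumes C: "brouwer_circuit n C" and c: "c < 4"
    and p: "0 \<le> p" "p \<le> 1" "margins n n p > 0"
    and q: "0 \<le> q" "q \<le> 1" "margins n n q > 0"
    and r: "0 \<le> r" "r \<le> 1" "margins n n r > 0"
  shows "selector n C p q r c =
    of_bool (brouwer_fun n C (index n n p) (index n n q) (index n n r) = c)"
proof -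
  obtain gs o1 o2 where Ceq: "C = (gs, o1, o2)" by (cases C) auto
  have wf: "\<forall>k<length gs. bgate_wf (3 * n) k (gs ! k)" and o: "o1 < length gs" "o2 < length gs"
    using C by (auto simp: brouwer_circuit_def bcircuit_wf_def Ceq)
  define X where "X = cube_input n (index n n p) (index n n q) (index n n r)"
  have "input_digit n p q r i = of_bool (X i)" if "i < 3 * n" for i
    using that digit_nbit[OF p, of i] digit_nbit[OF q, of "i - n"] digit_nbit[OF r, of "i - 2 * n"]
    by (auto simp: input_digit_def X_def cube_input_def)
  from arith_vals_of_bool[OF wf this]
  have bit: "circuit_bit n C p q r k = of_bool (bvals X gs ! k)" if "k < length gs" for k
    using that by (simp add: circuit_bit_def Ceq)
  have out: "bcircuit_out C X = (bvals X gs ! o1, bvals X gs ! o2)"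
    by (simp add: bcircuit_out_def Ceq Let_def)
  have c_cases: "c = 0 \<or> c = 1 \<or> c = 2 \<or> c = 3" using c by auto
  \<comment> \<open>The case split on the two bits below turns them into the numerals 0 and 1, which
    no longer match the rules about \<open>of_bool\<close>.\<close>
  have "arith_not 0 = 1" "arith_not 1 = 0" "arith_and 0 0 = 0" "arith_and 0 1 = 0"
    "arith_and 1 0 = 0" "arith_and 1 1 = 1"
    by (auto simp: arith_not_def arith_and_def clip_def)
  then have inner: "inner_colour n C p q r c =
      of_bool (2 * of_bool (bvals X gs ! o1) + of_bool (bvals X gs ! o2) = c)"
    using c_cases bit[OF o(1)] bit[OF o(2)]
    by (cases "bvals X gs ! o1"; cases "bvals X gs ! o2") (auto simp: inner_colour_def Ceq)
  show ?thesis
    unfolding selector_def inner no_zero_face_def max_face_def Let_def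
      nonzero_index_correct[OF p] nonzero_index_correct[OF q] nonzero_index_correct[OF r]
      max_index_correct[OF p] max_index_correct[OF q] max_index_correct[OF r]
      arith_not_of_bool arith_and_of_bool arith_or_of_bool if_distrib[of of_bool, symmetric]
      of_bool_eq_iff brouwer_fun_def X_def[symmetric] out prod.case
    using c_cases
    by (cases "index n n p = 0"; cases "index n n q = 0"; cases "index n n r = 0") auto
qed


lemma computable_from_selector:
  assumes C: "brouwer_circuit n C"
    and p: "\<And>t. t < n \<Longrightarrow> (\<lambda>x. digit n (residue n t (p x))) \<in> A"
    and q: "\<And>t. t < n \<Longrightarrow> (\<lambda>x. digit n (residue n t (q x))) \<in> A"
    and r: "\<And>t. t < n \<Longrightarrow> (\<lambda>x. digit n (residue n t (r x))) \<in> A"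
  shows "computable_from (6 * n + 2 * bsize C + 126) A
    ((\<lambda>c x. selector n C (p x) (q x) (r x) c) ` {..<4})"
proof -
  obtain gs o1 o2 where Ceq: "C = (gs, o1, o2)" by (cases C) auto
  have wf: "\<forall>k<length gs. bgate_wf (3 * n) k (gs ! k)" and o: "o1 < length gs" "o2 < length gs"
    using C by (auto simp: brouwer_circuit_def bcircuit_wf_def Ceq)
  have "(\<lambda>x. input_digit n (p x) (q x) (r x) i) \<in> A" if "i < 3 * n" for i
    using that p[of "n - 1 - i"] q[of "n - 1 - (i - n)"] r[of "n - 1 - (i - 2 * n)"]
    by (cases "i < n"; cases "i < 2 * n") (auto simp: input_digit_def)
  from computable_from_arith_vals[OF wf this]
  have bits: "computable_from (2 * bsize C) A
     {\<lambda>x. circuit_bit n C (p x) (q x) (r x) o1, \<lambda>x. circuit_bit n C (p x) (q x) (r x) o2}"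
    (is "computable_from _ _ ?bits")
    by (rule computable_from_mono) (use o in \<open>auto simp: circuit_bit_def Ceq bsize_def\<close>)
  let ?flags = "{\<lambda>x. nonzero_index n (p x)} \<union> ({\<lambda>x. nonzero_index n (q x)} \<union>
    ({\<lambda>x. nonzero_index n (r x)} \<union> ({\<lambda>x. max_index n (p x)} \<union> ({\<lambda>x. max_index n (q x)} \<union>
     ({\<lambda>x. max_index n (r x)} \<union> ?bits)))))"
  have flags: "computable_from ((n + 1) + ((n + 1) + ((n + 1) + ((n + 1) + ((n + 1) + ((n + 1) + 2 * bsize C))))))
      A ?flags"
    unfolding nonzero_index_def max_index_def
    using p q r bits by (intro computable_from_Un computable_from_ex computable_from_all)
  \<comment> \<open>The flags and circuit bits are available by now, so each colour adds only a
    constant number of connectives.\<close>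
  have "computable_from 30 (A \<union> ?flags) {\<lambda>x. selector n C (p x) (q x) (r x) c}" if "c < 4" for c
  proof -
    have "c = 0 \<or> c = 1 \<or> c = 2 \<or> c = 3" using that by auto
    moreover have "computable_from 30 (A \<union> ?flags) {\<lambda>x. selector n C (p x) (q x) (r x) 0}"
      unfolding selector_def no_zero_face_def max_face_def inner_colour_def Let_def Ceq fst_conv snd_conv
      by (simp only: insert_iff empty_iff if_True if_False simp_thms zero_neq_numeral zero_neq_one,
        rule computable_from_weaken,
        (rule computable_from_and computable_from_or computable_from_not | (rule computable_from_mem, simp add: Ceq))+)
        simp
    moreover have "computable_from 30 (A \<union> ?flags) {\<lambda>x. selector n C (p x) (q x) (r x) 1}"
      unfolding selector_def no_zero_face_def max_face_def inner_colour_def Let_def Ceq fst_conv snd_conv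
      by (simp only: insert_iff empty_iff if_True if_False simp_thms one_eq_numeral_iff num.distinct,
        rule computable_from_weaken,
        (rule computable_from_and computable_from_or computable_from_not | (rule computable_from_mem, simp add: Ceq))+)
        simp
    moreover have "computable_from 30 (A \<union> ?flags) {\<lambda>x. selector n C (p x) (q x) (r x) 2}"
      unfolding selector_def no_zero_face_def max_face_def inner_colour_def Let_def Ceq fst_conv snd_conv
      by (simp only: insert_iff empty_iff if_True if_False simp_thms numeral_eq_one_iff numeral_eq_iff num.distinct num.inject,
        rule computable_from_weaken,
        (rule computable_from_and computable_from_or computable_from_not | (rule computable_from_mem, simp add: Ceq))+)
        simp
    moreover have "computable_from 30 (A \<union> ?flags) {\<lambda>x. selector n C (p x) (q x) (r x) 3}"
      unfolding selector_def no_zero_face_def max_face_def inner_colour_def Let_def Ceq fst_conv snd_conv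
      by (simp only: insert_iff empty_iff if_True if_False simp_thms numeral_eq_one_iff numeral_eq_iff num.distinct num.inject,
        rule computable_from_weaken,
        (rule computable_from_and computable_from_or computable_from_not | (rule computable_from_mem, simp add: Ceq))+)
        simp
    ultimately show ?thesis by blast
  qed
  from computable_from_trans'[OF flags computable_from_UN[of 4, OF this]]
  show ?thesis
    by (simp only: UNION_singleton_eq_range) (rule computable_from_weaken, assumption, simp)
qed

section \<open>Averaging over shifted samples\<close>

primrec remaining :: "(nat \<Rightarrow> real) \<Rightarrow> nat \<Rightarrow> real" where
  "remaining g 0 = 1"
| "remaining g (Suc s) = clip (remaining g s - clip (min (remaining g s) (g s)))"

definition weight :: "(nat \<Rightarrow> real) \<Rightarrow> nat \<Rightarrow> real" where
  "weight g s = clip (min (remaining g s) (g s))"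

primrec clip_sum :: "(nat \<Rightarrow> real) \<Rightarrow> nat \<Rightarrow> real" where
  "clip_sum f 0 = 0"
| "clip_sum f (Suc t) = clip (clip_sum f t + f t)"

lemma weight_ge_0: "0 \<le> weight g s"
  by (simp add: weight_def)

lemma weight_pos: "weight g s > 0 \<Longrightarrow> g s > 0"
  by (auto simp: weight_def clip_def split: if_splits)

lemma remaining_bounds: "0 \<le> remaining g s" "remaining g s \<le> 1"
  by (cases s; simp)+

lemma weight_eq: "0 \<le> g s \<Longrightarrow> weight g s = min (remaining g s) (g s)"
  using remaining_bounds[of g s] by (simp add: weight_def clip_id min.coboundedI1)

lemma remaining_Suc: "0 \<le> g s \<Longrightarrow> remaining g (Suc s) = remaining g s - weight g s"
  using remaining_bounds[of g s] weight_eq[of g s]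
  by (simp add: weight_def[symmetric] clip_id)

lemma remaining_eq:
  "(\<And>s. 0 \<le> g s) \<Longrightarrow> remaining g S = 1 - (\<Sum>s<S. weight g s)"
  by (induction S) (simp_all add: remaining_Suc del: remaining.simps(2))

text \<open>A sample with value exactly 1 takes everything that is left, so the remainder is 0 from
  then on. A merely positive value would not be enough.\<close>

lemma sum_weight:
  assumes g: "\<And>s. 0 \<le> g s" and s: "s < S" "g s = 1"
  shows "(\<Sum>s<S. weight g s) = 1"
proof -
  have "Suc s \<le> S" using s by simp
  then have "remaining g S = 0"
  proof (induction rule: dec_induct)
    case base
    have "weight g s = remaining g s"
      using weight_eq[of g s] s remaining_bounds[of g s] by simp
    then show ?case using remaining_Suc[of g s] s by simp
  next
    case (step k)
    then show ?case using remaining_Suc[of g k] weight_eq[of g k] g by simp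
  qed
  then show ?thesis using remaining_eq[of g S] g by simp
qed

text \<open>The terms are nonnegative, so every partial sum is bounded by the total and no
  intermediate truncation acts.\<close>

lemma clip_sum_eq:
  assumes "\<And>t. t < T \<Longrightarrow> 0 \<le> f t" "(\<Sum>t<T. f t) \<le> 1"
  shows "clip_sum f T = (\<Sum>t<T. f t)"
  using assms
proof (induction T)
  case (Suc T)
  have nonneg: "0 \<le> (\<Sum>t<T. f t)" "0 \<le> f T" using Suc.prems(1) by (auto intro: sum_nonneg)
  with Suc.prems(2) have "(\<Sum>t<T. f t) \<le> 1" by simp
  with Suc have "clip_sum f T = (\<Sum>t<T. f t)" by simp
  with Suc.prems(2) nonneg show ?case by (simp add: clip_id)
qed simp

text \<open>The recursion mentions the previous remainder twice and the count does not share it,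
  hence a bound exponential in S. Only S up to 3 occurs.\<close>

lemma computable_from_remaining:
  assumes "\<And>s. s < S \<Longrightarrow> (\<lambda>x. g x s) \<in> A"
  shows "computable_from (4 ^ S) A {\<lambda>x. remaining (g x) S}"
  using assms
proof (induction S)
  case 0
  then show ?case by (simp add: computable_from_const[simplified])
next
  case (Suc S)
  then have IH: "computable_from (4 ^ S) A {\<lambda>x. remaining (g x) S}" by simp
  have "computable_from (4 ^ S + (4 ^ S + 0 + 1) + 1) A {\<lambda>x. remaining (g x) (Suc S)}"
    unfolding remaining.simps using Suc.prems
    by (intro computable_from_sub computable_from_min computable_from_mem IH) simp
  then show ?case
    by (rule computable_from_weaken) (use one_le_power[of "4::nat" S] in simp)
qed

lemma computable_from_weight:
  assumes "\<And>t. t \<le> s \<Longrightarrow> (\<lambda>x. g x t) \<in> A"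
  shows "computable_from (4 ^ s + 1) A {\<lambda>x. weight (g x) s}"
  using computable_from_min[OF computable_from_remaining computable_from_mem, of s g A "\<lambda>x. g x s"] assms
  by (simp add: weight_def)

lemma computable_from_clip_sum:
  assumes "\<And>t. t < T \<Longrightarrow> computable_from k A {\<lambda>x. f x t}"
  shows "computable_from (T * (k + 1) + 1) A {\<lambda>x. clip_sum (f x) T}"
  using assms
proof (induction T)
  case (Suc T)
  then have "computable_from (T * (k + 1) + 1 + k + 1) A {\<lambda>x. clip_sum (f x) (Suc T)}"
    unfolding clip_sum.simps by (intro computable_from_add) auto
  then show ?case by (rule computable_from_weaken) simp
qed (simp add: computable_from_const[simplified])

text \<open>A coordinate shifted beyond 1 is truncated to 1, for which all bits in
  \<open>index\<close> are ones, so the sample falls into the last layer.\<close>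

definition sample :: "nat \<Rightarrow> nat \<Rightarrow> point \<Rightarrow> nat \<Rightarrow> real" where
  "sample n s x m = clip (comp x m + real s / (8 * 2 ^ n))"

definition goodness :: "nat \<Rightarrow> point \<Rightarrow> nat \<Rightarrow> real" where
  "goodness n x s = arith_and (arith_and (margins n n (sample n s x 0)) (margins n n (sample n s x 1)))
     (margins n n (sample n s x 2))"

definition sample_selector :: "nat \<Rightarrow> bcircuit \<Rightarrow> point \<Rightarrow> nat \<Rightarrow> nat \<Rightarrow> real" where
  "sample_selector n C x s c = selector n C (sample n s x 0) (sample n s x 1) (sample n s x 2) c"

definition vote :: "nat \<Rightarrow> bcircuit \<Rightarrow> point \<Rightarrow> nat \<Rightarrow> nat \<Rightarrow> real" where
  "vote n C x c s = arith_and (weight (goodness n x) s) (sample_selector n C x s c)"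

definition tally :: "nat \<Rightarrow> bcircuit \<Rightarrow> point \<Rightarrow> nat \<Rightarrow> real" where
  "tally n C x c = clip_sum (vote n C x c) 4"

text \<open>One of the two clipped differences is zero, so adding the positive part before subtracting the
  negative one causes no truncation.\<close>

definition displaced :: "nat \<Rightarrow> bcircuit \<Rightarrow> point \<Rightarrow> nat \<Rightarrow> real" where
  "displaced n C x m =
     clip (clip (comp x m + clip (1 / 2 ^ (2 * n) * clip (tally n C x (Suc m) - tally n C x 0)))
       - clip (1 / 2 ^ (2 * n) * clip (tally n C x 0 - tally n C x (Suc m))))"

section \<open>Gate counts for a sample and for a displaced coordinate\<close>

lemma computable_from_sample:
  assumes "brouwer_circuit n C" "s < 4"
  shows "computable_from (57 * n + 2 * bsize C + 140) {}
    (insert (\<lambda>x. goodness n x s) ((\<lambda>c x. sample_selector n C x s c) ` {..<4}))"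
proof -
  have s1: "real s / (8 * 2 ^ n) \<le> 1"
  proof -
    have "real s \<le> 8 * 1" using assms(2) by simp
    also have "\<dots> \<le> 8 * 2 ^ n" by simp
    finally show ?thesis by simp
  qed
  have "computable_from 3 {} {\<lambda>x. sample n s x m}" if "m < 3" for m
    unfolding sample_def
    by (rule computable_from_weaken, (rule computable_from_add computable_from_comp computable_from_const; (use that s1 in simp)?)+)
      simp
  from computable_from_UN[of 3, OF this]
  have P: "computable_from 9 {} ((\<lambda>m x. sample n s x m) ` {..<3})" (is "computable_from _ _ ?P")
    by (simp add: UNION_singleton_eq_range)
  let ?D = "\<lambda>m. insert (\<lambda>x. margins n n (sample n s x m))
    ((\<lambda>t x. digit n (residue n t (sample n s x m))) ` {..<n})"
  have "computable_from (17 * n + 1) ?P (?D m)" if "m < 3" for m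
    by (rule computable_from_digits) (use that in auto)
  from computable_from_UN[of 3, OF this]
  have D: "computable_from (3 * (17 * n + 1)) ?P (\<Union>m<3. ?D m)" .
  then have D: "computable_from (9 + 3 * (17 * n + 1)) {} (\<Union>m<3. ?D m)"
    by (intro computable_from_trans'[OF P]) simp
  have m: "(\<lambda>x. margins n n (sample n s x m)) \<in> (\<Union>m<3. ?D m)" if "m < 3" for m
    using that by blast
  have d: "(\<lambda>x. digit n (residue n t (sample n s x m))) \<in> (\<Union>m<3. ?D m)" if "m < 3" "t < n" for m t
    using that by blast
  have "computable_from (0 + 0 + 1 + 0 + 1) (\<Union>m<3. ?D m) {\<lambda>x. goodness n x s}"
    unfolding goodness_def by (intro computable_from_and computable_from_mem m) auto
  moreover have "computable_from (6 * n + 2 * bsize C + 126) (\<Union>m<3. ?D m)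
      ((\<lambda>c x. sample_selector n C x s c) ` {..<4})"
    unfolding sample_selector_def
    by (rule computable_from_selector[OF assms(1)]) (intro d; simp)+
  ultimately have "computable_from (0 + 0 + 1 + 0 + 1 + (6 * n + 2 * bsize C + 126)) (\<Union>m<3. ?D m)
      (insert (\<lambda>x. goodness n x s) ((\<lambda>c x. sample_selector n C x s c) ` {..<4}))"
    using computable_from_Un by fastforce
  then have "computable_from (9 + 3 * (17 * n + 1) + (0 + 0 + 1 + 0 + 1 + (6 * n + 2 * bsize C + 126))) {}
      (insert (\<lambda>x. goodness n x s) ((\<lambda>c x. sample_selector n C x s c) ` {..<4}))"
    by (intro computable_from_trans'[OF D]) simp
  then show ?thesis by (rule computable_from_weaken) simp
qed

lemma computable_from_displaced:
  assumes "brouwer_circuit n C" "m < 3"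
  shows "computable_from (228 * n + 8 * bsize C + 1800) {} {\<lambda>x. displaced n C x m}"
proof -
  let ?B = "\<lambda>s. insert (\<lambda>x. goodness n x s) ((\<lambda>c x. sample_selector n C x s c) ` {..<4})"
  let ?A = "\<Union>s<4. ?B s"
  have A: "computable_from (4 * (57 * n + 2 * bsize C + 140)) {} ?A"
    using computable_from_UN[of 4, OF computable_from_sample[OF assms(1)]] .
  have "computable_from 67 ?A {\<lambda>x. vote n C x c s}" if "c < 4" "s < 4" for c s
  proof -
    have "computable_from (4 ^ s + 1) ?A {\<lambda>x. weight (goodness n x) s}"
      using that by (intro computable_from_weight) force
    moreover have "(\<lambda>x. sample_selector n C x s c) \<in> ?A" using that by blast
    ultimately have "computable_from (4 ^ s + 1 + 0 + 1) ?A {\<lambda>x. vote n C x c s}"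
      unfolding vote_def by (intro computable_from_and computable_from_mem)
    moreover have "4 ^ s \<le> (4::nat) ^ 3" using that by (intro power_increasing) auto
    ultimately show ?thesis by (elim computable_from_weaken) simp
  qed
  then have tally: "computable_from 273 ?A {\<lambda>x. tally n C x c}" if "c < 4" for c
    unfolding tally_def using computable_from_clip_sum[of 4 67 ?A "\<lambda>x. vote n C x c"] that by simp
  have "computable_from 1150 ?A {\<lambda>x. displaced n C x m}"
    unfolding displaced_def
    by (rule computable_from_weaken, (rule computable_from_gate
        | (rule computable_from_comp tally, use assms in simp))+) simp
  then have "computable_from 1150 ({} \<union> ?A) {\<lambda>x. displaced n C x m}" by simp
  from computable_from_trans'[OF A this] show ?thesis
    by (rule computable_from_weaken) simp
qed

section \<open>Colours and weights of the four samples\<close>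

definition colour :: "nat \<Rightarrow> bcircuit \<Rightarrow> point \<Rightarrow> nat \<Rightarrow> nat" where
  "colour n C x s = brouwer_fun n C (index n n (sample n s x 0)) (index n n (sample n s x 1))
     (index n n (sample n s x 2))"

lemma comp_bounds: "x \<in> cubeK \<Longrightarrow> 0 \<le> comp x m" "x \<in> cubeK \<Longrightarrow> comp x m \<le> 1"
  by (auto simp: cubeK_def comp_def)

lemma sample_bounds [simp]: "0 \<le> sample n s x m" "sample n s x m \<le> 1"
  by (auto simp: sample_def)

text \<open>The shifts differ by multiples of \<open>1 / (8 * 2 ^ n)\<close> that are smaller than the grid width,
  so each coordinate can spoil at most one of the four samples.\<close>

lemma ex_good_sample:
  assumes "x \<in> cubeK"
  shows "\<exists>s<4. goodness n x s = 1"
proof -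
  define bad where "bad m = {s. s < 4 \<and>
    (\<exists>j::nat. \<bar>comp x m + real s / (8 * 2 ^ n) - real j / 2 ^ n\<bar> < 1 / (16 * 2 ^ n))}" for m
  have fin: "finite (bad m)" for m by (simp add: bad_def)
  \<comment> \<open>In this unit the grid spacing is 16, the shifts are 2s and the spoilt zones have
    radius 1, which leaves a question about integers.\<close>
  have scale: "\<bar>16 * 2 ^ n * y + 2 * real s - 16 * real j\<bar> < 1"
    if "\<bar>y + real s / (8 * 2 ^ n) - real j / 2 ^ n\<bar> < 1 / (16 * 2 ^ n)" for y s j
  proof -
    have "16 * 2 ^ n * y + 2 * real s - 16 * real j
      = 16 * 2 ^ n * (y + real s / (8 * 2 ^ n) - real j / 2 ^ n)"
      by (simp add: field_simps)
    then have "\<bar>16 * 2 ^ n * y + 2 * real s - 16 * real j\<bar>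
      = 16 * 2 ^ n * \<bar>y + real s / (8 * 2 ^ n) - real j / 2 ^ n\<bar>"
      by (simp add: abs_mult)
    also have "\<dots> < 16 * 2 ^ n * (1 / (16 * 2 ^ n))"
      using that by (intro mult_strict_left_mono) auto
    finally show ?thesis by simp
  qed
  have one: "card (bad m) \<le> Suc 0" for m
    unfolding card_le_Suc0_iff_eq[OF fin]
  proof (intro ballI)
    fix s s' assume "s \<in> bad m" "s' \<in> bad m"
    then obtain j j' where b: "s < 4" "s' < 4"
      "\<bar>16 * 2 ^ n * comp x m + 2 * real s - 16 * real j\<bar> < 1"
      "\<bar>16 * 2 ^ n * comp x m + 2 * real s' - 16 * real j'\<bar> < 1"
      unfolding bad_def mem_Collect_eq using scale[of "comp x m"] by blast
    then have "\<bar>2 * real s - 16 * real j - (2 * real s' - 16 * real j')\<bar> < 2"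
      by linarith
    then have "\<bar>2 * int s - 16 * int j - (2 * int s' - 16 * int j')\<bar> < 2"
      by linarith
    \<comment> \<open>An even integer of absolute value below 2 is zero, and two shift numbers below
      4 cannot differ by a nonzero multiple of 8.\<close>
    moreover have "d = 8 * k" if "\<bar>2 * d - 16 * k\<bar> < 2" for d k :: int
      using that by presburger
    from this[of "int s - int s'" "int j - int j'"] calculation
    have "int s - int s' = 8 * (int j - int j')" by (simp add: algebra_simps)
    moreover have "- 4 < int s - int s'" "int s - int s' < 4" using b(1,2) by linarith+
    moreover have "d = 0" if "d = 8 * k" "- 4 < d" "d < 4" for d k :: int
      using that by presburger
    ultimately have "int s - int s' = 0" by blast
    then show "s = s'" by simp
  qed
  have "card (bad 0 \<union> bad 1 \<union> bad 2) \<le> card (bad 0) + card (bad 1) + card (bad 2)"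
    by (meson add_le_mono1 card_Un_le order_trans)
  also have "\<dots> < card {..<4::nat}"
    using one[of 0] one[of 1] one[of 2] by simp
  finally have "\<not> {..<4} \<subseteq> bad 0 \<union> bad 1 \<union> bad 2"
    using card_mono[of "bad 0 \<union> bad 1 \<union> bad 2" "{..<4::nat}"] fin by auto
  then obtain s where s: "s < 4" "s \<notin> bad 0" "s \<notin> bad 1" "s \<notin> bad 2" by auto
  have "margins n n (sample n s x m) = 1" if "s \<notin> bad m" for m
  proof (rule margins_eq_1)
    fix j :: nat assume j: "0 < j" "j < 2 ^ n"
    define z where "z = comp x m + real s / (8 * 2 ^ n)"
    have z: "\<bar>z - real j / 2 ^ n\<bar> \<ge> 1 / (16 * 2 ^ n)" "z \<ge> 0"
      using that s(1) comp_bounds(1)[OF assms, of m] by (auto simp: bad_def z_def not_less)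
    have "real j + 1 \<le> 2 ^ n"
      using j(2) by (metis Suc_leI add.commute of_nat_Suc of_nat_le_iff of_nat_numeral of_nat_power)
    then have "(real j + 1) / 2 ^ n \<le> 1" by simp
    then have "1 - real j / 2 ^ n \<ge> 1 / 2 ^ n" by (simp add: add_divide_distrib)
    moreover have "1 / 2 ^ n \<ge> (1::real) / (16 * 2 ^ n)" by (simp add: field_simps)
    \<comment> \<open>If z exceeds 1, the sample is 1 and at least a whole cell width away from
      every interior grid point.\<close>
    ultimately show "\<bar>sample n s x m - real j / 2 ^ n\<bar> \<ge> 1 / (16 * 2 ^ n)"
      unfolding sample_def z_def[symmetric] using z by (cases "z \<le> 1") (auto simp: clip_def)
  qed auto
  with s show ?thesis
    by (intro exI[of _ s]) (simp add: goodness_def arith_and_def clip_id)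
qed

lemma goodness_ge_0: "0 \<le> goodness n x s"
  by (simp add: goodness_def arith_and_def)

lemma sum_weight_goodness:
  assumes "x \<in> cubeK"
  shows "(\<Sum>s<4. weight (goodness n x) s) = 1"
  using ex_good_sample[OF assms, of n] sum_weight[of "goodness n x" _ 4] goodness_ge_0 by blast

lemma margins_pos:
  assumes "weight (goodness n x) s > 0" "m < 3"
  shows "margins n n (sample n s x m) > 0"
proof -
  have "goodness n x s > 0" using weight_pos[OF assms(1)] .
  moreover have "m = 0 \<or> m = 1 \<or> m = 2" using assms(2) by auto
  ultimately show ?thesis
    by (auto simp: goodness_def arith_and_def clip_def min_def split: if_splits)
qed

lemma vote_eq:
  assumes "brouwer_circuit n C" "c < 4"
  shows "vote n C x c s = weight (goodness n x) s * of_bool (colour n C x s = c)"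
proof (cases "weight (goodness n x) s > 0")
  case True
  have "sample_selector n C x s c = of_bool (colour n C x s = c)"
    unfolding sample_selector_def colour_def
    using assms margins_pos[OF True] by (intro selector_correct) auto
  moreover have "weight (goodness n x) s \<le> 1" by (simp add: weight_def)
  ultimately show ?thesis
    using True by (simp add: vote_def arith_and_def clip_id min_def)
next
  case False
  then have "weight (goodness n x) s = 0" using weight_ge_0[of "goodness n x" s] by simp
  then show ?thesis by (simp add: vote_def arith_and_def clip_def)
qed

lemma tally_eq:
  assumes "brouwer_circuit n C" "x \<in> cubeK" "c < 4"
  shows "tally n C x c = (\<Sum>s<4. weight (goodness n x) s * of_bool (colour n C x s = c))"
proof -
  have "(\<Sum>s<4. weight (goodness n x) s * of_bool (colour n C x s = c)) \<le> (\<Sum>s<4. weight (goodness n x) s)"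
    by (intro sum_mono) (simp add: weight_ge_0)
  then show ?thesis
    unfolding tally_def using sum_weight_goodness[OF assms(2), of n]
    by (subst clip_sum_eq) (simp_all add: vote_eq[OF assms(1,3)] weight_ge_0)
qed

lemma tally_bounds:
  assumes "brouwer_circuit n C" "x \<in> cubeK" "c < 4"
  shows "0 \<le> tally n C x c" "tally n C x c \<le> 1"
proof -
  have "(\<Sum>s<4. weight (goodness n x) s * of_bool (colour n C x s = c)) \<le> (\<Sum>s<4. weight (goodness n x) s)"
    by (intro sum_mono) (simp add: weight_ge_0)
  then show "tally n C x c \<le> 1"
    unfolding tally_eq[OF assms] using sum_weight_goodness[OF assms(2), of n] by simp
  show "0 \<le> tally n C x c"
    unfolding tally_eq[OF assms] by (intro sum_nonneg) (simp add: weight_ge_0)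
qed

text \<open>Shifts go upwards by at most 3/8 of a cell, and truncation at 1 never takes a sample
  below x. Hence the slack 3/8 appears on one side only.\<close>

lemma index_sample:
  assumes "weight (goodness n x) s > 0" "m < 3" "s < 4" "x \<in> cubeK"
  shows "real (index n n (sample n s x m)) \<le> 2 ^ n * comp x m + 3 / 8"
    and "2 ^ n * comp x m \<le> real (index n n (sample n s x m)) + 1"
proof -
  note b = index_bounds[OF sample_bounds margins_pos[OF assms(1,2)]]
  note c = comp_bounds[OF assms(4), of m]
  have "sample n s x m \<le> comp x m + real s / (8 * 2 ^ n)"
    using c by (auto simp: sample_def clip_def)
  also have "\<dots> \<le> comp x m + 3 / (8 * 2 ^ n)"
    using assms(3) by (intro add_left_mono divide_right_mono) auto
  finally have "2 ^ n * sample n s x m \<le> 2 ^ n * (comp x m + 3 / (8 * 2 ^ n))" by simp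
  also have "\<dots> = 2 ^ n * comp x m + 3 / 8" by (simp add: distrib_left)
  finally have "2 ^ n * sample n s x m \<le> 2 ^ n * comp x m + 3 / 8" .
  moreover have "real (index n n (sample n s x m)) \<le> 2 ^ n * sample n s x m"
    using b(1) by (simp add: field_simps)
  ultimately show "real (index n n (sample n s x m)) \<le> 2 ^ n * comp x m + 3 / 8"
    by linarith
  have "comp x m \<le> sample n s x m" using c by (auto simp: sample_def clip_def)
  from order_trans[OF this b(2)]
  have "comp x m \<le> (real (index n n (sample n s x m)) + 1) / 2 ^ n" by (simp add: add.commute)
  then show "2 ^ n * comp x m \<le> real (index n n (sample n s x m)) + 1"
    by (simp add: field_simps)
qed

text \<open>The largest shift, 3/8 of a cell, is smaller than the half cell between a centre and the
  wall above it.\<close>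

lemma index_sample_center:
  assumes "weight (goodness n x) s > 0" "m < 3" "s < 4" "x \<in> cubeK"
    and "comp x m = (real k + 1 / 2) / 2 ^ n"
  shows "index n n (sample n s x m) = k"
  using index_sample[OF assms(1-4)] unfolding assms(5) by simp

lemma colour_less: "colour n C x s < 4"
  by (auto simp: colour_def brouwer_fun_def of_bool_def split: prod.split)

section \<open>Absence of truncation near the faces\<close>

lemma alpha_le:
  assumes "n \<ge> 1"
  shows "1 / 2 ^ (2 * n) \<le> (1 / (2 * 2 ^ n) :: real)"
proof -
  have "(2::real) ^ Suc n \<le> 2 ^ (2 * n)" using assms by (intro power_increasing) auto
  then show ?thesis by (intro divide_left_mono) auto
qed

text \<open>Below alpha, hence below half a cell, a shift by at most 3/8 of a cell still ends in
  layer 0, where the colouring rule gives 1, 2 or 3. So no sample that counts pulls the point down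
  through this face.\<close>

lemma tally_0_eq_0:
  assumes "n \<ge> 1" "brouwer_circuit n C" "x \<in> cubeK" "m < 3" "comp x m < 1 / 2 ^ (2 * n)"
  shows "tally n C x 0 = 0"
proof -
  have "2 ^ n * comp x m < 2 ^ n * (1 / (2 * 2 ^ n))"
    using assms(5) alpha_le[OF assms(1)] by (intro mult_strict_left_mono) auto
  then have low: "2 ^ n * comp x m < 1 / 2" by simp
  have "colour n C x s \<noteq> 0" if "weight (goodness n x) s > 0" "s < 4" for s
  proof -
    have "index n n (sample n s x m) = 0"
      using index_sample(1)[OF that(1) assms(4) that(2) assms(3)] low by simp
    moreover have "m = 0 \<or> m = 1 \<or> m = 2" using assms(4) by auto
    ultimately show ?thesis by (auto simp: colour_def brouwer_fun_def)
  qed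
  then have "weight (goodness n x) s * of_bool (colour n C x s = 0) = 0" if "s < 4" for s
    using that weight_ge_0[of "goodness n x" s] by (cases "weight (goodness n x) s > 0") auto
  then have "(\<Sum>s<4. weight (goodness n x) s * of_bool (colour n C x s = 0)) = 0"
    by (intro sum.neutral) auto
  then show ?thesis using tally_eq[OF assms(2,3), of 0] by (simp del: sum_mult_of_bool_eq)
qed

text \<open>Samples that count lie in the last layer of coordinate m. An exterior cubelet gets
  colour \<open>Suc m\<close> only if its index m is 0, so nothing pushes the point up through this
  face.\<close>

lemma tally_Suc_eq_0:
  assumes "n \<ge> 1" "brouwer_circuit n C" "x \<in> cubeK" "m < 3" "comp x m > 1 - 1 / 2 ^ (2 * n)"
  shows "tally n C x (Suc m) = 0"
proof -
  have "2 ^ n * comp x m > 2 ^ n * (1 - 1 / (2 * 2 ^ n))"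
    using assms(5) alpha_le[OF assms(1)] by (intro mult_strict_left_mono) auto
  then have high: "2 ^ n * comp x m > 2 ^ n - 1 / 2" by (simp add: algebra_simps)
  have "colour n C x s \<noteq> Suc m" if "weight (goodness n x) s > 0" "s < 4" for s
  proof -
    let ?i = "index n n (sample n s x m)"
    have "real ?i + 1 > real (2 ^ n) - 1 / 2"
      using index_sample(2)[OF that(1) assms(4) that(2) assms(3)] high by simp
    then have "?i + 1 \<ge> 2 ^ n" by linarith
    then have "?i = 2 ^ n - 1" using index_less[of n n "sample n s x m"] by simp
    \<comment> \<open>For n >= 1 the last layer differs from layer 0, the only exterior layer that
      can carry the colour \<open>Suc m\<close>.\<close>
    moreover have "(2::nat) ^ n - 1 \<noteq> 0"
      using assms(1) power_increasing[of 1 n "2::nat"] by simp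
    moreover have "m = 0 \<or> m = 1 \<or> m = 2" using assms(4) by auto
    ultimately show ?thesis by (auto simp: colour_def brouwer_fun_def)
  qed
  then have "weight (goodness n x) s * of_bool (colour n C x s = Suc m) = 0" if "s < 4" for s
    using that weight_ge_0[of "goodness n x" s] by (cases "weight (goodness n x) s > 0") auto
  then have "(\<Sum>s<4. weight (goodness n x) s * of_bool (colour n C x s = Suc m)) = 0"
    by (intro sum.neutral) auto
  then show ?thesis using tally_eq[OF assms(2,3), of "Suc m"] assms(4) by (simp del: sum_mult_of_bool_eq)
qed

text \<open>A downward move has length at most a and happens only if x >= a; an upward one only if x
  <= 1 - a. So the target lies in [0,1] and no truncation distorts it.\<close>

lemma clip_displacement:
  assumes "0 \<le> x" "x \<le> 1" "0 \<le> a" "a \<le> 1" "0 \<le> u" "u \<le> 1" "0 \<le> v" "v \<le> 1"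
    and low: "x < a \<Longrightarrow> v = 0" and high: "x > 1 - a \<Longrightarrow> u = 0"
  shows "clip (clip (x + clip (a * clip (u - v))) - clip (a * clip (v - u))) = x + a * (u - v)"
proof (cases "u \<ge> v")
  case True
  have d: "0 \<le> u - v" "u - v \<le> 1" using assms True by auto
  have e: "0 \<le> a * (u - v)" "a * (u - v) \<le> a" "a * (u - v) \<le> 1"
    using d assms(3,4) by (auto intro: mult_left_le mult_le_one)
  have "x + a * (u - v) \<le> 1"
  proof (cases "x > 1 - a")
    case True
    then have "u - v \<le> 0" using high assms by simp
    then have "u - v = 0" using d by simp
    then show ?thesis using assms by simp
  qed (use e in linarith)
  moreover have "clip (v - u) = 0" using True by (simp add: clip_def)
  ultimately show ?thesis using d e assms(1) by (simp add: clip_id)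
next
  case False
  have d: "0 \<le> v - u" "v - u \<le> 1" using assms False by auto
  have e: "0 \<le> a * (v - u)" "a * (v - u) \<le> a" "a * (v - u) \<le> 1"
    using d assms(3,4) by (auto intro: mult_left_le mult_le_one)
  have "x - a * (v - u) \<ge> 0"
  proof (cases "x < a")
    case True
    then have "v - u \<le> 0" using low assms by simp
    then have "v - u = 0" using d by simp
    then show ?thesis using assms by simp
  qed (use e in linarith)
  moreover have "clip (u - v) = 0" using False by (simp add: clip_def)
  moreover have "x + a * (u - v) = x - a * (v - u)" by (simp add: algebra_simps)
  moreover have "clip 0 = 0" by (simp add: clip_def)
  ultimately show ?thesis using d e assms(1,2) by (simp add: clip_id)
qed

lemma displaced_eq:
  assumes "n \<ge> 1" "brouwer_circuit n C" "x \<in> cubeK" "m < 3"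
  shows "displaced n C x m = comp x m + 1 / 2 ^ (2 * n) * (tally n C x (Suc m) - tally n C x 0)"
  unfolding displaced_def
  using assms comp_bounds[OF assms(3), of m] tally_bounds[OF assms(2,3), of "Suc m"]
    tally_bounds[OF assms(2,3), of 0] tally_0_eq_0[OF assms] tally_Suc_eq_0[OF assms]
  by (intro clip_displacement) auto

section \<open>The assembled map and its displacements\<close>

definition brouwer_map :: "nat \<Rightarrow> bcircuit \<Rightarrow> point \<Rightarrow> point" where
  "brouwer_map n C x = (displaced n C x 0, displaced n C x 1, displaced n C x 2)"

lemma brouwer_map_in_cubeK: "brouwer_map n C x \<in> cubeK"
  by (simp add: brouwer_map_def cubeK_def displaced_def)

text \<open>With indicators in place of cases, coordinate m depends linearly on the indicators of
  the colours m+1 and 0, the two whose tallies enter \<open>displaced\<close>.\<close>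

lemma delta_eq:
  "c < 4 \<Longrightarrow> delta n c = (1 / 2 ^ (2 * n) * (of_bool (c = 1) - of_bool (c = 0)),
     1 / 2 ^ (2 * n) * (of_bool (c = 2) - of_bool (c = 0)),
     1 / 2 ^ (2 * n) * (of_bool (c = 3) - of_bool (c = 0)))"
  by (auto simp: delta_def Let_def)

lemma brouwer_map_diff:
  assumes "n \<ge> 1" "brouwer_circuit n C" "x \<in> cubeK"
  shows "brouwer_map n C x - x = (\<Sum>s<4. weight (goodness n x) s *\<^sub>R delta n (colour n C x s))"
proof -
  define w where "w = weight (goodness n x)"
  define k where "k = colour n C x"
  have comp: "displaced n C x m - comp x m =
      (\<Sum>s<4. w s * (1 / 2 ^ (2 * n) * (of_bool (k s = Suc m) - of_bool (k s = 0))))"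
    if "m < 3" for m
    unfolding displaced_eq[OF assms that]
    using tally_eq[OF assms(2,3), of 0] tally_eq[OF assms(2,3), of "Suc m"] that
    by (simp add: w_def k_def sum_subtractf sum_divide_distrib right_diff_distrib
        diff_divide_distrib del: sum_mult_of_bool_eq)
  have "brouwer_map n C x - x =
      (displaced n C x 0 - comp x 0, displaced n C x 1 - comp x 1, displaced n C x 2 - comp x 2)"
    by (cases x) (simp add: brouwer_map_def comp_def)
  also have "\<dots> = (\<Sum>s<4. w s *\<^sub>R delta n (k s))"
    by (simp add: comp delta_eq colour_less k_def prod_eq_iff fst_sum snd_sum numeral_2_eq_2 numeral_3_eq_3)
  finally show ?thesis by (simp add: w_def k_def)
qed

lemma center_in_cubeK:
  assumes "i < 2 ^ n" "j < 2 ^ n" "k < 2 ^ n"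
  shows "center n i j k \<in> cubeK"
proof -
  have "(real i + 1 / 2) / 2 ^ n \<le> 1" if "i < 2 ^ n" for i :: nat
  proof -
    have "real i + 1 \<le> real (2 ^ n)" using that by linarith
    then show ?thesis by simp
  qed
  then show ?thesis using assms by (simp add: center_def cubeK_def)
qed

text \<open>All samples of positive weight have the indices of the centre itself, so a single colour
  collects the total weight 1.\<close>

lemma brouwer_map_center:
  assumes "n \<ge> 1" "brouwer_circuit n C" "i < 2 ^ n" "j < 2 ^ n" "k < 2 ^ n"
  shows "brouwer_map n C (center n i j k) - center n i j k = delta n (brouwer_fun n C i j k)"
proof -
  let ?x = "center n i j k"
  have x: "?x \<in> cubeK" using center_in_cubeK assms by simp
  have "colour n C ?x s = brouwer_fun n C i j k" if "weight (goodness n ?x) s > 0" "s < 4" for s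
    unfolding colour_def
    using index_sample_center[OF that(1) _ that(2) x, of 0 i] index_sample_center[OF that(1) _ that(2) x, of 1 j]
      index_sample_center[OF that(1) _ that(2) x, of 2 k]
    by (simp add: center_def comp_def)
  then have "weight (goodness n ?x) s *\<^sub>R delta n (colour n C ?x s) =
      weight (goodness n ?x) s *\<^sub>R delta n (brouwer_fun n C i j k)" if "s < 4" for s
    using that weight_ge_0[of "goodness n ?x" s] by (cases "weight (goodness n ?x) s > 0") auto
  then have "brouwer_map n C ?x - ?x =
      (\<Sum>s<4. weight (goodness n ?x) s *\<^sub>R delta n (brouwer_fun n C i j k))"
    unfolding brouwer_map_diff[OF assms(1,2) x] by (intro sum.cong) auto
  also have "\<dots> = delta n (brouwer_fun n C i j k)"
    using sum_weight_goodness[OF x, of n] by (simp flip: scaleR_left.sum)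
  finally show ?thesis .
qed

lemma brouwer_map_implements:
  assumes "n \<ge> 1" "brouwer_circuit n C"
  shows "implements n (brouwer_fun n C) (brouwer_map n C)"
  unfolding implements_def
proof (intro conjI ballI impI)
  show "\<forall>i<2 ^ n. \<forall>j<2 ^ n. \<forall>k<2 ^ n.
      brouwer_map n C (center n i j k) - center n i j k = delta n (brouwer_fun n C i j k)"
    using brouwer_map_center[OF assms] by blast
next
  fix x assume x: "x \<in> cubeK"
  let ?H = "{brouwer_map n C z - z | z. is_center n z \<and> linf_dist x z \<le> 1 / 2 ^ n}"
  \<comment> \<open>Samples of weight 0 must be left out: their indices may come from garbage
    residues and name a cubelet far from x.\<close>
  define S where "S = {s. s < 4 \<and> weight (goodness n x) s > 0}"
  have S: "S \<subseteq> {..<4}" "finite S" by (auto simp: S_def)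
  have zero: "\<forall>s\<in>{..<4} - S. weight (goodness n x) s = 0"
    using weight_ge_0[of "goodness n x"] by (auto simp: S_def order_less_le)
  have "(\<Sum>s\<in>S. weight (goodness n x) s) = 1"
    using sum.mono_neutral_left[OF _ S(1) zero] sum_weight_goodness[OF x, of n] by simp
  moreover have "delta n (colour n C x s) \<in> convex hull ?H" if "s \<in> S" for s
  proof -
    have s: "s < 4" "weight (goodness n x) s > 0" using that by (auto simp: S_def)
    define I where "I m = index n n (sample n s x m)" for m
    \<comment> \<open>At the centre of the cubelet named by the sample, the displacement is exactly
      \<open>delta\<close> of the colour of the sample; so the weighted average is one of
      displacements at centres.\<close>
    define z where "z = center n (I 0) (I 1) (I 2)"
    have less: "I m < 2 ^ n" for m by (simp add: I_def index_less)
    have near: "\<bar>comp x m - (real (I m) + 1 / 2) / 2 ^ n\<bar> \<le> 1 / 2 ^ n" if "m < 3" for m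
    proof -
      \<comment> \<open>\<open>index_sample\<close> bounds the difference by 1/2 from above and by
        -7/8 from below.\<close>
      have "\<bar>2 ^ n * comp x m - (real (I m) + 1 / 2)\<bar> \<le> 1"
        using index_sample[OF s(2) that s(1) x] unfolding I_def by linarith
      moreover have "comp x m - (real (I m) + 1 / 2) / 2 ^ n =
          (2 ^ n * comp x m - (real (I m) + 1 / 2)) / 2 ^ n" by (simp add: field_simps)
      ultimately show ?thesis by (simp add: abs_divide divide_right_mono)
    qed
    have "linf_dist x z \<le> 1 / 2 ^ n"
      using near[of 0] near[of 1] near[of 2] by (simp add: linf_dist_def z_def center_def comp_def)
    moreover have "is_center n z" using less by (auto simp: is_center_def z_def)
    moreover have "brouwer_map n C z - z = delta n (colour n C x s)"
      using brouwer_map_center[OF assms less less less] by (simp add: z_def colour_def I_def)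
    ultimately have "delta n (colour n C x s) \<in> ?H" by (intro CollectI exI[of _ z]) simp
    then show ?thesis by (rule hull_inc)
  qed
  ultimately have "(\<Sum>s\<in>S. weight (goodness n x) s *\<^sub>R delta n (colour n C x s)) \<in> convex hull ?H"
    using S(2) by (intro convex_sum convex_convex_hull weight_ge_0) auto
  also have "(\<Sum>s\<in>S. weight (goodness n x) s *\<^sub>R delta n (colour n C x s)) =
      (\<Sum>s<4. weight (goodness n x) s *\<^sub>R delta n (colour n C x s))"
    using S(1) zero by (intro sum.mono_neutral_left) auto
  finally show "brouwer_map n C x - x \<in> convex hull ?H"
    by (simp add: brouwer_map_diff[OF assms x])
qed

theorem theorem2:
  shows "\<exists>c d :: nat. \<forall>n C. n \<ge> 1 \<longrightarrow> brouwer_circuit n C \<longrightarrow>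
     (\<exists>L F. lcomputes L F \<and> continuous_on cubeK F \<and> F ` cubeK \<subseteq> cubeK \<and>
            implements n (brouwer_fun n C) F \<and>
            lsize L \<le> c * (n + bsize C) ^ d)"
\<comment> \<open>The bound is linear: 6084 = 3 * (228 + 1800), where n >= 1 absorbs the additive
  constant of each of the three coordinates into the multiple of n.\<close>
proof (rule exI[of _ 6084], rule exI[of _ 1], intro allI impI)
  fix n C assume n: "n \<ge> 1" and C: "brouwer_circuit n C"
  let ?k = "228 * n + 8 * bsize C + 1800"
  note f = computable_from_displaced[OF C]
  have "computable_from (?k + (?k + ?k)) {} ({\<lambda>x. displaced n C x 0} \<union>
      ({\<lambda>x. displaced n C x 1} \<union> {\<lambda>x. displaced n C x 2}))"
    by (intro computable_from_Un f) auto
  then have "computable_from (?k + (?k + ?k)) {}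
      {\<lambda>x. displaced n C x 0, \<lambda>x. displaced n C x 1, \<lambda>x. displaced n C x 2}"
    by (simp add: insert_commute)
  from computable_from_lcircuit[OF this] obtain L where
    L: "lcomputes L (brouwer_map n C)" "continuous_on cubeK (brouwer_map n C)"
      "lsize L \<le> ?k + (?k + ?k)"
    by (auto simp: brouwer_map_def[abs_def])
  have "lsize L \<le> 6084 * (n + bsize C) ^ 1" using L(3) n by simp
  with L brouwer_map_in_cubeK brouwer_map_implements[OF n C] show
    "\<exists>L F. lcomputes L F \<and> continuous_on cubeK F \<and> F ` cubeK \<subseteq> cubeK \<and>
       implements n (brouwer_fun n C) F \<and> lsize L \<le> 6084 * (n + bsize C) ^ 1"
    by (intro exI[of _ L] exI[of _ "brouwer_map n C"]) blast
qed

end
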